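(* Let $\lambda\in\Lambda^+_{m|n}$ and $\Sigma\in\mathbb S$. Then $$\overline\lambda_\Sigma=\overline\lambda+\sum_{\alpha\in B_\Sigma}c_\lambda(\alpha)\cdot\alpha .$$
   Context: Fix $m,n\ge 0$ and the complex Lie superalgebra $\mathfrak{gl}(m|n)$ with Cartan subalgebra $\mathfrak h$ of diagonal matrices. Let $\varepsilon_1,\dots,\varepsilon_m,\delta_1,\dots,\delta_n$ be the basis of $\mathfrak h^*$ dual to $E_{1,1},\dots,E_{m+n,m+n}$. The root system $\Delta$ consists of the even roots $\varepsilon_i-\varepsilon_j$, $\delta_i-\delta_j$ ($i\ne j$) and the odd roots $\pm(\varepsilon_i-\delta_j)$. A base is a linearly independent $\Sigma\subset\Delta$ such that every root is an integer combination of elements of $\Sigma$ with all coefficients $\ge0$ (positive roots for $\Sigma$) or all $\le 0$. The distinguished base is $\Sigma^{\mathrm{dist}}=\{\varepsilon_i-\varepsilon_{i+1},\ \varepsilon_m-\delta_1,\ \delta_j-\delta_{j+1}\}$. $\mathbb S$ is the set of bases whose positive even roots are exactly $\{\varepsilon_i-\varepsilon_j,\delta_i-\delta_j\mid i<j\}$. Right odd roots: $\mathcal R=\{\varepsilon_i-\delta_j\mid 1\le i\le m,1\le j\le n\}$, partially ordered by $\varepsilon_i-\delta_j\le\varepsilon_k-\delta_l$ iff $i\ge k$ and $j\le l$. For $\Sigma\in\mathbb S$, $B_\Sigma:=\mathcal R\setminus\{\alpha\in\mathcal R\mid\exists\,\beta\in\Sigma\cap\mathcal R:\alpha\ge\beta\}$.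 Weights: $\nu=\sum a_i\varepsilon_i+\sum b_j\delta_j$ is written $(a_1\dots a_m|b_1\dots b_n)$, with $\nu_i:=a_i$, $\nu_{-j}:=b_j$. $\Lambda^+_{m|n}$ is the set of weights $\lambda$ with integer coordinates, $\lambda_1\ge\dots\ge\lambda_m$ and $\lambda_{-1}\ge\dots\ge\lambda_{-n}$. $L(\lambda)$ is the simple finite-dimensional $\mathfrak{gl}(m|n)$-module with highest weight $\lambda$ with respect to $\Sigma^{\mathrm{dist}}$; $\lambda_\Sigma$ is the highest weight of $L(\lambda)$ with respect to the base $\Sigma$. $\rho_\Sigma$ is half the sum of positive even roots minus half the sum of positive odd roots for $\Sigma$, shifted by $r(1\dots1|-1\dots-1)$ with $r\in\{0,\tfrac12\}$ (depending only on $m+n$) so that its coordinates are integers. $\overline\lambda_\Sigma:=\lambda_\Sigma+\rho_\Sigma$ and $\overline\lambda:=\overline\lambda_{\Sigma^{\mathrm{dist}}}$. Arrow diagram: define recursively for $i=m,m-1,\dots,1$ $$k_i:=\min\{c\in\mathbb Z\mid c\ge\overline\lambda_i,\ c\ne-\overline\lambda_{-j}\ \forall 1\le j\le n,\ c\ne k_{i'}\ \forall i<i'\le m\},$$ and $M_i:=\#\{j\in\{1,\dots,n\}\mid-\overline\lambda_{-j}<k_i\}$. Change tracking diagram: $c_\lambda:\mathcal R\to\{0,1\}$, $c_\lambda(\varepsilon_i-\delta_j)=1$ if $M_i-(k_i-\overline\lambda_i-1)\le j\le M_i$, and $0$ otherwise. *)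

theory Defs
  imports
    Complex_Main
    "HOL-Library.Function_Algebras"
    "HOL-Library.Z2"
    "Jordan_Normal_Form.Matrix"
begin

section \<open>The Lie superalgebra gl(m|n)\<close>

text \<open>
  Matrices are 0-indexed: rows and columns \<open>0, \<dots>, m - 1\<close> are the even ones and
  \<open>m, \<dots>, m + n - 1\<close> the odd ones. Parities are elements of the two-element field \<open>bit\<close>.
\<close>

definition gl_carrier :: "nat \<Rightarrow> nat \<Rightarrow> complex mat set" where
  "gl_carrier m n = carrier_mat (m + n) (m + n)"

definition gl_part :: "nat \<Rightarrow> nat \<Rightarrow> bit \<Rightarrow> complex mat set" where
  "gl_part m n p =
     {x \<in> gl_carrier m n. \<forall>i<m + n. \<forall>j<m + n. x $$ (i, j) \<noteq> 0 \<longrightarrow> of_bool ((i < m) \<noteq> (j < m)) = p}"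

definition super_sign :: "bit \<Rightarrow> bit \<Rightarrow> complex" where
  "super_sign p q = (if p = 1 \<and> q = 1 then - 1 else 1)"

text \<open>The superbracket of homogeneous elements \<open>x\<close>, \<open>y\<close> of parities \<open>p\<close>, \<open>q\<close>.\<close>

definition superbracket :: "bit \<Rightarrow> bit \<Rightarrow> complex mat \<Rightarrow> complex mat \<Rightarrow> complex mat" where
  "superbracket p q x y = x * y - super_sign p q \<cdot>\<^sub>m (y * x)"

definition cartan :: "nat \<Rightarrow> nat \<Rightarrow> complex mat set" where
  "cartan m n = {h \<in> gl_carrier m n. diagonal_mat h}"


section \<open>Weights\<close>

text \<open>
  A weight \<open>\<nu> = (a\<^sub>1 \<dots> a\<^sub>m | b\<^sub>1 \<dots> b\<^sub>n)\<close> is its coordinate function, with \<open>\<nu> i = a\<^sub>i\<close> for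
  \<open>1 \<le> i \<le> m\<close> and \<open>\<nu> (- j) = b\<^sub>j\<close> for \<open>1 \<le> j \<le> n\<close>, and value 0 elsewhere.
\<close>

type_synonym weight = "int \<Rightarrow> complex"

definition indices :: "nat \<Rightarrow> nat \<Rightarrow> int set" where
  "indices m n = {1..int m} \<union> {- int n..- 1}"

definition weight_space_dual :: "nat \<Rightarrow> nat \<Rightarrow> weight set" where
  "weight_space_dual m n = {\<nu>. \<forall>k. k \<notin> indices m n \<longrightarrow> \<nu> k = 0}"

definition wscale :: "complex \<Rightarrow> weight \<Rightarrow> weight" where
  "wscale c \<nu> = (\<lambda>k. c * \<nu> k)"

text \<open>The matrix row of an index, so that coordinates refer to the basis dual to the diagonal
  matrix units.\<close>

definition row_of :: "nat \<Rightarrow> int \<Rightarrow> nat" where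
  "row_of m k = (if k > 0 then nat k - 1 else m + nat (- k) - 1)"

definition weight_eval :: "nat \<Rightarrow> nat \<Rightarrow> weight \<Rightarrow> complex mat \<Rightarrow> complex" where
  "weight_eval m n \<nu> h = (\<Sum>k\<in>indices m n. \<nu> k * h $$ (row_of m k, row_of m k))"

definition eps :: "nat \<Rightarrow> weight" where
  "eps i = (\<lambda>k. if k = int i then 1 else 0)"

definition del :: "nat \<Rightarrow> weight" where
  "del j = (\<lambda>k. if k = - int j then 1 else 0)"


section \<open>Roots and bases\<close>

definition even_roots :: "nat \<Rightarrow> nat \<Rightarrow> weight set" where
  "even_roots m n =
     {eps i - eps j | i j. i \<in> {1..m} \<and> j \<in> {1..m} \<and> i \<noteq> j} \<union>
     {del i - del j | i j. i \<in> {1..n} \<and> j \<in> {1..n} \<and> i \<noteq> j}"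

definition right_odd_roots :: "nat \<Rightarrow> nat \<Rightarrow> weight set" where
  "right_odd_roots m n = {eps i - del j | i j. i \<in> {1..m} \<and> j \<in> {1..n}}"

definition odd_roots :: "nat \<Rightarrow> nat \<Rightarrow> weight set" where
  "odd_roots m n = right_odd_roots m n \<union> uminus ` right_odd_roots m n"

definition roots :: "nat \<Rightarrow> nat \<Rightarrow> weight set" where
  "roots m n = even_roots m n \<union> odd_roots m n"

definition positive_roots :: "nat \<Rightarrow> nat \<Rightarrow> weight set \<Rightarrow> weight set" where
  "positive_roots m n S =
     {\<alpha> \<in> roots m n. \<exists>c :: weight \<Rightarrow> nat. \<alpha> = (\<Sum>\<beta>\<in>S. wscale (of_nat (c \<beta>)) \<beta>)}"

definition is_base :: "nat \<Rightarrow> nat \<Rightarrow> weight set \<Rightarrow> bool" where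
  "is_base m n S \<longleftrightarrow>
     S \<subseteq> roots m n \<and> \<not> Modules.module.dependent wscale S \<and>
     (\<forall>\<alpha>\<in>roots m n. \<alpha> \<in> positive_roots m n S \<or> - \<alpha> \<in> positive_roots m n S)"

definition dist_base :: "nat \<Rightarrow> nat \<Rightarrow> weight set" where
  "dist_base m n =
     {eps i - eps (i + 1) | i. 1 \<le> i \<and> i < m} \<union>
     (if 1 \<le> m \<and> 1 \<le> n then {eps m - del 1} else {}) \<union>
     {del j - del (j + 1) | j. 1 \<le> j \<and> j < n}"

definition standard_bases :: "nat \<Rightarrow> nat \<Rightarrow> weight set set" where
  "standard_bases m n =
     {S. is_base m n S \<and>
         positive_roots m n S \<inter> even_roots m n =
           {eps i - eps j | i j. 1 \<le> i \<and> i < j \<and> j \<le> m} \<union>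
           {del i - del j | i j. 1 \<le> i \<and> i < j \<and> j \<le> n}}"

definition root_le :: "nat \<Rightarrow> nat \<Rightarrow> weight \<Rightarrow> weight \<Rightarrow> bool" where
  "root_le m n \<alpha> \<beta> \<longleftrightarrow>
     (\<exists>i\<in>{1..m}. \<exists>j\<in>{1..n}. \<exists>k\<in>{1..m}. \<exists>l\<in>{1..n}.
        \<alpha> = eps i - del j \<and> \<beta> = eps k - del l \<and> i \<ge> k \<and> j \<le> l)"

definition B_set :: "nat \<Rightarrow> nat \<Rightarrow> weight set \<Rightarrow> weight set" where
  "B_set m n S =
     right_odd_roots m n -
       {\<alpha> \<in> right_odd_roots m n. \<exists>\<beta>\<in>S \<inter> right_odd_roots m n. root_le m n \<beta> \<alpha>}"

text \<open>The shift makes the coordinates of \<open>rho\<close> integers: for the distinguished base the unshifted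
  first coordinate is \<open>(m - n - 1) / 2\<close>, and the coordinates for other bases differ by integers.\<close>

definition rho :: "nat \<Rightarrow> nat \<Rightarrow> weight set \<Rightarrow> weight" where
  "rho m n S =
     wscale (1/2) (\<Sum>\<alpha>\<in>positive_roots m n S \<inter> even_roots m n. \<alpha>)
     - wscale (1/2) (\<Sum>\<alpha>\<in>positive_roots m n S \<inter> odd_roots m n. \<alpha>)
     + wscale (if even (m + n) then 1/2 else 0) ((\<Sum>i\<in>{1..m}. eps i) - (\<Sum>j\<in>{1..n}. del j))"


section \<open>Supermodules\<close>

text \<open>\<open>V p\<close> is the homogeneous component of parity \<open>p\<close> of the module, whose underlying space is the
  whole type.\<close>

locale gl_supermodule = vector_space scale
  for scale :: "complex \<Rightarrow> 'v::ab_group_add \<Rightarrow> 'v" +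
  fixes m n :: nat
    and V :: "bit \<Rightarrow> 'v set"
    and act :: "complex mat \<Rightarrow> 'v \<Rightarrow> 'v"
  assumes subspace_V: "subspace (V p)"
    and V_Int: "V 0 \<inter> V 1 = {0}"
    and V_sum: "\<exists>a\<in>V 0. \<exists>b\<in>V 1. v = a + b"
    and act_add_right: "x \<in> gl_carrier m n \<Longrightarrow> act x (v + w) = act x v + act x w"
    and act_scale_right: "x \<in> gl_carrier m n \<Longrightarrow> act x (scale c v) = scale c (act x v)"
    and act_add_left:
      "x \<in> gl_carrier m n \<Longrightarrow> y \<in> gl_carrier m n \<Longrightarrow> act (x + y) v = act x v + act y v"
    and act_scale_left: "x \<in> gl_carrier m n \<Longrightarrow> act (c \<cdot>\<^sub>m x) v = scale c (act x v)"
    and act_parity: "x \<in> gl_part m n p \<Longrightarrow> v \<in> V q \<Longrightarrow> act x v \<in> V (p + q)"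
    and act_superbracket:
      "x \<in> gl_part m n p \<Longrightarrow> y \<in> gl_part m n q \<Longrightarrow>
         act (superbracket p q x y) v =
           act x (act y v) - scale (super_sign p q) (act y (act x v))"
begin

definition finite_dimensional :: bool where
  "finite_dimensional \<longleftrightarrow> (\<exists>B. finite B \<and> span B = UNIV)"

definition subsupermodule :: "'v set \<Rightarrow> bool" where
  "subsupermodule W \<longleftrightarrow>
     subspace W \<and>
     (\<forall>w\<in>W. \<exists>a\<in>W \<inter> V 0. \<exists>b\<in>W \<inter> V 1. w = a + b) \<and>
     (\<forall>x\<in>gl_carrier m n. \<forall>w\<in>W. act x w \<in> W)"

definition simple :: bool where
  "simple \<longleftrightarrow>
     (UNIV :: 'v set) \<noteq> {0} \<and> (\<forall>W. subsupermodule W \<longrightarrow> W = {0} \<or> W = UNIV)"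

end

text \<open>The Cartan subalgebra is even, so its superbracket with any element is the commutator.\<close>

definition root_space :: "nat \<Rightarrow> nat \<Rightarrow> weight \<Rightarrow> complex mat set" where
  "root_space m n \<alpha> =
     {x \<in> gl_carrier m n. \<forall>h\<in>cartan m n. h * x - x * h = weight_eval m n \<alpha> h \<cdot>\<^sub>m x}"

context gl_supermodule
begin

text \<open>
  These notions are meant for simple modules, where a highest weight vector automatically
  generates the module and the highest weight exists (in finite dimension) and is unique.
\<close>

definition has_highest_weight :: "weight set \<Rightarrow> weight \<Rightarrow> bool" where
  "has_highest_weight S \<mu> \<longleftrightarrow>
     \<mu> \<in> weight_space_dual m n \<and>
     (\<exists>v. v \<noteq> 0 \<and>
          (\<forall>h\<in>cartan m n. act h v = scale (weight_eval m n \<mu> h) v) \<and>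
          (\<forall>\<alpha>\<in>positive_roots m n S. \<forall>x\<in>root_space m n \<alpha>. act x v = 0))"

definition highest_weight :: "weight set \<Rightarrow> weight" where
  "highest_weight S = (THE \<mu>. has_highest_weight S \<mu>)"

end


section \<open>Dominant weights and the change tracking diagram\<close>

text \<open>Only used for weights with integer coordinates, where it returns the coordinates.\<close>

definition int_coord :: "weight \<Rightarrow> int \<Rightarrow> int" where
  "int_coord \<nu> k = \<lfloor>Re (\<nu> k)\<rfloor>"

definition dominant_weights :: "nat \<Rightarrow> nat \<Rightarrow> weight set" where
  "dominant_weights m n =
     {\<nu> \<in> weight_space_dual m n.
        (\<forall>k. \<nu> k \<in> \<int>) \<and>
        (\<forall>i j. 1 \<le> i \<and> i \<le> j \<and> j \<le> int m \<longrightarrow> int_coord \<nu> i \<ge> int_coord \<nu> j) \<and>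
        (\<forall>i j. 1 \<le> i \<and> i \<le> j \<and> j \<le> int n \<longrightarrow> int_coord \<nu> (- i) \<ge> int_coord \<nu> (- j))}"

text \<open>The arguments \<open>a\<close> below are the integer coordinates of the \<open>\<rho>\<close>-shifted weight.\<close>

function arrow_end :: "nat \<Rightarrow> nat \<Rightarrow> (int \<Rightarrow> int) \<Rightarrow> nat \<Rightarrow> int" where
  "arrow_end m n a i =
     (LEAST c. c \<ge> a (int i) \<and> (\<forall>j\<in>{1..n}. c \<noteq> - a (- int j)) \<and>
               (\<forall>i'\<in>{i<..m}. c \<noteq> arrow_end m n a i'))"
  by pat_completeness auto
termination
  by (relation "Wellfounded.measure (\<lambda>(m, n, a, i). m - i)") auto

declare arrow_end.simps [simp del]

definition arrow_count :: "nat \<Rightarrow> nat \<Rightarrow> (int \<Rightarrow> int) \<Rightarrow> nat \<Rightarrow> nat" where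
  "arrow_count m n a i = card {j \<in> {1..n}. - a (- int j) < arrow_end m n a i}"

definition change_tracking :: "nat \<Rightarrow> nat \<Rightarrow> weight \<Rightarrow> weight \<Rightarrow> nat" where
  "change_tracking m n lam \<alpha> =
     (let a = int_coord (lam + rho m n (dist_base m n)) in
      if \<exists>i\<in>{1..m}. \<exists>j\<in>{1..n}.
           \<alpha> = eps i - del j \<and>
           int (arrow_count m n a i) - (arrow_end m n a i - a (int i) - 1) \<le> int j \<and>
           j \<le> arrow_count m n a i
      then 1 else 0)"

end

(*
  A base with the standard even positive roots is a shuffle of the epsilons and the deltas, encoded
  by the Young diagram B of the cells (i, j) for which delta_j precedes epsilon_i.  Adding a corner
  (i, j) to B is the odd reflection at epsilon_i - delta_j.  If f is the root vector of the negative
  of this root and v is a highest weight vector before the reflection, then f v is one after it,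
  unless f v = 0.  With e the opposite root vector, e f v = (mu_i + mu_{-j}) v, and if this scalar is
  zero, then f v is singular for the old base of a different weight, so that f v = 0 by uniqueness
  of the highest weight.  In rho-shifted coordinates, the weight therefore changes by the root iff
  the i-th epsilon-coordinate equals the negated j-th delta-coordinate at that moment.

  Processing the rows i = m, ..., 1 in this way, row i increments a maximal run of consecutive
  values of the increasing sequence of negated delta-coordinates, starting at the value of the i-th
  epsilon-coordinate; the run ends exactly at the end k_i of the i-th arrow.
*)
theory Submission
  imports Defs
begin

subsection \<open>Arrow diagrams as row insertion\<close>

text \<open>A chain of odd reflections from the distinguished base to a given one need not run row
  by row, whereas arrows are defined row by row. The two fit because the test at a corner (i, j)
  depends only on the changes made at the cells (i, l) with l < j and (k, j) with k > i, and these
  cells lie in every diagram to which (i, j) can be added. Hence the marks satisfy one recursion on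
  the whole rectangle, \<open>arrow_cell_iff\<close>, which mentions no diagram: it is solved in row
  order and then used along any chain. Arrow ends avoid the original negated delta-coordinates and
  the earlier arrow ends, not the current coordinates. At and above the start of the current row
  both sets agree: replacing a run x, ..., k - 1 by x + 1, ..., k adds k and loses only x, which
  lies below the next start because the epsilon-coordinates are strictly decreasing. Uniqueness of
  the highest weight is needed for every order of the epsilons and deltas. One Cartan element, whose
  diagonal entries are the positions in that order, takes the place of weight space
  decompositions.\<close>

lemma card_strict_mono_preimage:
  fixes D :: "nat \<Rightarrow> int"
  assumes D: "strict_mono_on {1..n} D" and sub: "{a..<b} \<subseteq> D ` {1..n}" and "a \<le> b"
  shows "int (card {l \<in> {1..n}. a \<le> D l \<and> D l < b}) = b - a"
proof -
  have "D ` {l \<in> {1..n}. a \<le> D l \<and> D l < b} = {a..<b}"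
    using sub by fastforce
  moreover have "inj_on D {l \<in> {1..n}. a \<le> D l \<and> D l < b}"
    using strict_mono_on_imp_inj_on[OF D] by (rule inj_on_subset) auto
  ultimately have "card {l \<in> {1..n}. a \<le> D l \<and> D l < b} = card {a..<b}"
    using card_image by fastforce
  then show ?thesis using \<open>a \<le> b\<close> by simp
qed

text \<open>The indices with \<open>D l < x\<close> form an initial segment of
  \<open>{1..n}\<close>, whose last index is its cardinality. This turns the bound by
  \<open>arrow_count\<close> into a comparison of values.\<close>

lemma strict_mono_below_iff:
  fixes D :: "nat \<Rightarrow> int"
  assumes D: "strict_mono_on {1..n} D" and j: "j \<in> {1..n}"
  shows "j \<le> card {l \<in> {1..n}. D l < x} \<longleftrightarrow> D j < x"
proof
  assume "D j < x"
  have "{1..j} \<subseteq> {l \<in> {1..n}. D l < x}"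
  proof
    fix l assume l: "l \<in> {1..j}"
    then have "D l \<le> D j"
      using strict_mono_onD[OF D _ j, of l] j by (cases "l = j") auto
    with l j \<open>D j < x\<close> show "l \<in> {l \<in> {1..n}. D l < x}" by auto
  qed
  then show "j \<le> card {l \<in> {1..n}. D l < x}"
    using card_mono[of "{l \<in> {1..n}. D l < x}" "{1..j}"] by simp
next
  assume le: "j \<le> card {l \<in> {1..n}. D l < x}"
  show "D j < x"
  proof (rule ccontr)
    assume n: "\<not> D j < x"
    have "{l \<in> {1..n}. D l < x} \<subseteq> {1..<j}"
    proof
      fix l assume l: "l \<in> {l \<in> {1..n}. D l < x}"
      then have "\<not> j \<le> l"
        using n strict_mono_onD[OF D j, of l] by (cases "j = l") auto
      then show "l \<in> {1..<j}" using l by auto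
    qed
    from card_mono[OF _ this] have "card {l \<in> {1..n}. D l < x} \<le> j - 1" by simp
    with le j show False by (simp only: atLeastAtMost_iff) linarith
  qed
qed

text \<open>Here \<open>a\<close> is the epsilon-coordinate at the start of a row, \<open>k\<close>
  the arrow end and \<open>D\<close> the increasing sequence of current values. The values a, ..., k
  - 1 are all taken, so they occupy k - a consecutive indices ending at M: this is the window of the
  change tracking diagram. For the second part, a coordinate that starts at \<open>a\<close> and
  grows by one at each index of the run meets \<open>D j\<close> exactly at those indices.\<close>

lemma row_insertion:
  fixes D :: "nat \<Rightarrow> int"
  assumes D: "strict_mono_on {1..n} D" and "a \<le> k" and sub: "{a..<k} \<subseteq> D ` {1..n}"
    and k: "k \<notin> D ` {1..n}" and M: "M = card {l \<in> {1..n}. D l < k}" and j: "j \<in> {1..n}"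
  shows "int M - (k - a - 1) \<le> int j \<and> j \<le> M \<longleftrightarrow> a \<le> D j \<and> D j < k"
    and "a + int (card {l \<in> {1..<j}. a \<le> D l \<and> D l < k}) = D j \<longleftrightarrow> a \<le> D j \<and> D j < k"
proof -
  have "{l \<in> {1..n}. D l < k} =
    {l \<in> {1..n}. D l < a} \<union> {l \<in> {1..n}. a \<le> D l \<and> D l < k}"
    using \<open>a \<le> k\<close> by auto
  then have "M = card {l \<in> {1..n}. D l < a} + card {l \<in> {1..n}. a \<le> D l \<and> D l < k}"
    unfolding M by (subst card_Un_disjoint[symmetric]) auto
  then have "int M - (k - a) = int (card {l \<in> {1..n}. D l < a})"
    using card_strict_mono_preimage[OF D sub \<open>a \<le> k\<close>] by simp
  then have "int M - (k - a - 1) \<le> int j \<longleftrightarrow> \<not> j \<le> card {l \<in> {1..n}. D l < a}"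
    by linarith
  then show "int M - (k - a - 1) \<le> int j \<and> j \<le> M \<longleftrightarrow> a \<le> D j \<and> D j < k"
    by (simp only: M strict_mono_below_iff[OF D j] not_less)
  have less: "D l < D j \<longleftrightarrow> l < j" if "l \<in> {1..n}" for l
    using strict_mono_onD[OF D that j] strict_mono_onD[OF D j that]
    by (cases l j rule: linorder_cases) auto
  \<comment> \<open>Before index j only values below \<open>D j\<close> occur; cutting the run at
    \<open>min k (D j)\<close> treats an index inside the run and one beyond it alike.\<close>
  have set_eq: "{l \<in> {1..<j}. a \<le> D l \<and> D l < k} = {l \<in> {1..n}. a \<le> D l \<and> D l < min k (D j)}"
  proof (rule Collect_cong)
    fix l
    show "l \<in> {1..<j} \<and> a \<le> D l \<and> D l < k \<longleftrightarrow>
        l \<in> {1..n} \<and> a \<le> D l \<and> D l < min k (D j)"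
      using less[of l] j by auto
  qed
  \<comment> \<open>Left of the run the coordinate, at least \<open>a\<close>, exceeds
    \<open>D j\<close>; inside the run it has grown by exactly \<open>D j - a\<close>; beyond the
    run it has stopped at \<open>k\<close>, which is not a value of \<open>D\<close>.\<close>
  consider "D j < a" | "a \<le> D j" "D j < k" | "k < D j"
    using k j by (cases "D j" k rule: linorder_cases; cases "a \<le> D j") auto
  then show "a + int (card {l \<in> {1..<j}. a \<le> D l \<and> D l < k}) = D j \<longleftrightarrow> a \<le> D j \<and> D j < k"
  proof cases
    case 1
    then show ?thesis by auto
  next
    case 2
    then have "int (card {l \<in> {1..n}. a \<le> D l \<and> D l < D j}) = D j - a"
      using sub by (intro card_strict_mono_preimage[OF D]) auto
    moreover have "min k (D j) = D j" using 2 by simp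
    ultimately show ?thesis using 2 by (simp only: set_eq) simp
  next
    case 3
    then have "min k (D j) = k" by simp
    with 3 show ?thesis
      using card_strict_mono_preimage[OF D sub \<open>a \<le> k\<close>] by (simp only: set_eq) simp
  qed
qed

text \<open>The integers are not well-ordered, so the minimum is found among the natural offsets
  from \<open>a\<close>; one of them works because the half-line above \<open>a\<close> is infinite
  and \<open>X\<close> is finite.\<close>

lemma int_Least_avoiding:
  fixes a :: int
  assumes "finite X"
  defines "k \<equiv> LEAST c. c \<ge> a \<and> c \<notin> X"
  shows "a \<le> k" and "k \<notin> X" and "{a..<k} \<subseteq> X"
proof -
  have "infinite {a..}" by (rule infinite_Ici)
  with assms(1) obtain c where c: "c \<ge> a" "c \<notin> X"
    using finite_subset[of "{a..}" X] by auto
  define t where "t = (LEAST t. a + int t \<notin> X)"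
  have t: "a + int t \<notin> X"
    unfolding t_def by (rule LeastI[of _ "nat (c - a)"]) (use c in simp)
  have min: "a + int t \<le> c" if "a \<le> c \<and> c \<notin> X" for c
    using Least_le[of "\<lambda>t. a + int t \<notin> X" "nat (c - a)"] that unfolding t_def by auto
  have "k = a + int t"
    unfolding k_def by (rule Least_equality) (use t min in auto)
  with t show "a \<le> k" "k \<notin> X" by auto
  show "{a..<k} \<subseteq> X"
  proof
    fix c assume "c \<in> {a..<k}"
    then show "c \<in> X" using min[of c] \<open>k = a + int t\<close> by (cases "c \<in> X") auto
  qed
qed

definition arrow_cell :: "nat \<Rightarrow> nat \<Rightarrow> (int \<Rightarrow> int) \<Rightarrow> nat \<Rightarrow> nat \<Rightarrow> bool" where
  "arrow_cell m n a i j \<longleftrightarrow>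
     int (arrow_count m n a i) - (arrow_end m n a i - a (int i) - 1) \<le> int j \<and>
     j \<le> arrow_count m n a i"

text \<open>The negated \<open>\<delta>\<close>-coordinates after the rows \<open>m, \<dots>, i + 1\<close> have been processed.\<close>

definition shifted_coord :: "nat \<Rightarrow> nat \<Rightarrow> (int \<Rightarrow> int) \<Rightarrow> nat \<Rightarrow> nat \<Rightarrow> int" where
  "shifted_coord m n a i j = - a (- int j) + int (card {k \<in> {i<..m}. arrow_cell m n a k j})"

lemma arrow_end_props:
  fixes m n a i
  defines "X \<equiv> (\<lambda>j. - a (- int j)) ` {1..n} \<union> arrow_end m n a ` {i<..m}"
  shows "a (int i) \<le> arrow_end m n a i" and "arrow_end m n a i \<notin> X"
    and "{a (int i)..<arrow_end m n a i} \<subseteq> X"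
proof -
  have "arrow_end m n a i = (LEAST c. c \<ge> a (int i) \<and> c \<notin> X)"
    by (subst arrow_end.simps, rule arg_cong[where f = Least]) (auto simp: X_def)
  moreover have "finite X" by (simp add: X_def)
  ultimately show "a (int i) \<le> arrow_end m n a i" and "arrow_end m n a i \<notin> X"
    and "{a (int i)..<arrow_end m n a i} \<subseteq> X"
    using int_Least_avoiding[of X "a (int i)"] by simp_all
qed

lemma arrow_row_range:
  fixes m n a i
  defines "D \<equiv> shifted_coord m n a i" and "k \<equiv> arrow_end m n a i"
  assumes mem: "\<And>c. c \<ge> a (int i) \<Longrightarrow> c \<in> D ` {1..n} \<longleftrightarrow>
               c \<in> (\<lambda>j. - a (- int j)) ` {1..n} \<union> arrow_end m n a ` {i<..m}"
  shows "{a (int i)..<k} \<subseteq> D ` {1..n}" and "k \<notin> D ` {1..n}" and "a (int i) \<le> k"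
  using arrow_end_props[where m = m and n = n and a = a and i = i] mem
  by (auto simp: k_def subset_iff)

text \<open>Two translations are made. \<open>mem\<close> is for the arrow end, which avoids
  original values and earlier ends instead of current values; \<open>below\<close> is for
  \<open>arrow_count\<close>, which counts original values instead of current ones. At a level that
  no current value occupies, such as the arrow end, both counts agree.\<close>

lemma arrow_row_insertion:
  fixes m n a i
  defines "D \<equiv> shifted_coord m n a i" and "k \<equiv> arrow_end m n a i"
  assumes D: "strict_mono_on {1..n} D"
    and mem: "\<And>c. c \<ge> a (int i) \<Longrightarrow> c \<in> D ` {1..n} \<longleftrightarrow>
               c \<in> (\<lambda>j. - a (- int j)) ` {1..n} \<union> arrow_end m n a ` {i<..m}"
    and below: "\<And>c j. c \<ge> a (int i) \<Longrightarrow> c \<notin> D ` {1..n} \<Longrightarrow> j \<in> {1..n} \<Longrightarrow>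
               D j < c \<longleftrightarrow> - a (- int j) < c"
    and j: "j \<in> {1..n}"
  shows "arrow_cell m n a i j \<longleftrightarrow> a (int i) \<le> D j \<and> D j < k"
    and "a (int i) + int (card {l \<in> {1..<j}. arrow_cell m n a i l}) = D j \<longleftrightarrow>
           arrow_cell m n a i j"
proof -
  note range = arrow_row_range[where m = m and n = n and a = a and i = i, folded D_def k_def, OF mem]
  note sub = range(1) and k = range(3,2)
  have M: "arrow_count m n a i = card {l \<in> {1..n}. D l < k}"
    unfolding arrow_count_def using below[OF k] by (intro arg_cong[where f = card]) (auto simp: k_def)
  have cell: "arrow_cell m n a i l \<longleftrightarrow> a (int i) \<le> D l \<and> D l < k" if "l \<in> {1..n}" for l
    unfolding arrow_cell_def
    using row_insertion(1)[OF D k(1) sub k(2) M that] by (simp add: k_def)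
  from cell[OF j] show "arrow_cell m n a i j \<longleftrightarrow> a (int i) \<le> D j \<and> D j < k" .
  have "{l \<in> {1..<j}. arrow_cell m n a i l} = {l \<in> {1..<j}. a (int i) \<le> D l \<and> D l < k}"
    using cell j by auto
  then show "a (int i) + int (card {l \<in> {1..<j}. arrow_cell m n a i l}) = D j \<longleftrightarrow>
           arrow_cell m n a i j"
    using row_insertion(2)[OF D k(1) sub k(2) M j] cell[OF j] by simp
qed

lemma shifted_coord_step:
  assumes "i \<ge> 1" "i \<le> m"
  shows "shifted_coord m n a (i - 1) j = shifted_coord m n a i j + of_bool (arrow_cell m n a i j)"
proof -
  have "{i - 1<..m} = insert i {i<..m}" using assms by auto
  then have "{k \<in> {i - 1<..m}. arrow_cell m n a k j} =
      (if arrow_cell m n a i j then insert i else id) {k \<in> {i<..m}. arrow_cell m n a k j}"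
    by auto
  then show ?thesis by (simp add: shifted_coord_def)
qed

text \<open>The three parts serve different purposes: the strict order makes a run of values an
  interval of indices, the set of values identifies the arrow end, and the comparison at free levels
  identifies the arrow count. Together they reproduce themselves from row i + 1 to row i.\<close>

lemma shifted_coord_invariant:
  fixes a :: "int \<Rightarrow> int"
  assumes a: "\<And>i j. 1 \<le> i \<Longrightarrow> i < j \<Longrightarrow> j \<le> m \<Longrightarrow> a (int j) < a (int i)"
    and d: "\<And>i j. 1 \<le> i \<Longrightarrow> i < j \<Longrightarrow> j \<le> n \<Longrightarrow> a (- int j) < a (- int i)"
    and "1 \<le> i" "i \<le> m"
  shows "strict_mono_on {1..n} (shifted_coord m n a i) \<and>
    (\<forall>c \<ge> a (int i). c \<in> shifted_coord m n a i ` {1..n} \<longleftrightarrow>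
               c \<in> (\<lambda>j. - a (- int j)) ` {1..n} \<union> arrow_end m n a ` {i<..m}) \<and>
    (\<forall>c \<ge> a (int i). c \<notin> shifted_coord m n a i ` {1..n} \<longrightarrow>
       (\<forall>j\<in>{1..n}. shifted_coord m n a i j < c \<longleftrightarrow> - a (- int j) < c))"
  using \<open>i \<le> m\<close> \<open>1 \<le> i\<close>
proof (induction i rule: inc_induct)
  case base
  have "shifted_coord m n a m = (\<lambda>j. - a (- int j))"
    by (rule ext) (simp add: shifted_coord_def)
  then show ?case using d by (auto simp: strict_mono_on_def)
next
  case (step i)
  define D where "D = shifted_coord m n a (Suc i)"
  define D' where "D' = shifted_coord m n a i"
  define k where "k = arrow_end m n a (Suc i)"
  define x where "x = a (int (Suc i))"
  have lt: "x < a (int i)" using a[of i "Suc i"] step by (simp add: x_def)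
  have "1 \<le> Suc i" by simp
  note IH = step.IH[OF this, folded D_def x_def]
  from IH have D: "strict_mono_on {1..n} D" by blast
  have sub: "{x..<k} \<subseteq> D ` {1..n}" and kD: "k \<notin> D ` {1..n}"
    using arrow_row_range[where m = m and n = n and a = a and i = "Suc i", folded D_def k_def x_def]
      IH by auto
  have cell: "arrow_cell m n a (Suc i) j \<longleftrightarrow> x \<le> D j \<and> D j < k" if "j \<in> {1..n}" for j
    using arrow_row_insertion[of n m a "Suc i" j, folded D_def k_def x_def] IH that by auto
  have D': "D' j = D j + of_bool (x \<le> D j \<and> D j < k)" if "j \<in> {1..n}" for j
    using shifted_coord_step[of "Suc i" m n a j] step cell[OF that] by (simp add: D_def D'_def)
  have "strict_mono_on {1..n} D'"
  proof (rule strict_mono_onI)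
    fix r s assume rs: "r \<in> {1..n}" "s \<in> {1..n}" "r < s"
    then have "D r < D s" using D by (auto simp: strict_mono_on_def)
    \<comment> \<open>A collision needs \<open>D r\<close> at the top of the run and
      \<open>D s\<close> just above it, unmoved; then \<open>D s\<close> would be the free value
      \<open>k\<close>.\<close>
    moreover have "D s \<noteq> k" using kD rs by auto
    ultimately show "D' r < D' s" using D'[OF rs(1)] D'[OF rs(2)] by auto
  qed
  moreover have mem: "c \<in> D' ` {1..n} \<longleftrightarrow> c \<in> D ` {1..n} \<or> c = k" if c: "c \<ge> a (int i)" for c
  proof
    assume "c \<in> D' ` {1..n}"
    then obtain j where j: "j \<in> {1..n}" "c = D' j" by auto
    show "c \<in> D ` {1..n} \<or> c = k"
    proof (cases "x \<le> D j \<and> D j < k")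
      case True
      then have "c = D j + 1" using D'[OF j(1)] j(2) by simp
      then have "c = k \<or> c \<in> {x..<k}" using True by auto
      then show ?thesis using sub by auto
    next
      case False
      then show ?thesis using D'[OF j(1)] j by auto
    qed
  next
    assume *: "c \<in> D ` {1..n} \<or> c = k"
    show "c \<in> D' ` {1..n}"
    \<comment> \<open>After the move, \<open>c\<close> is taken either from \<open>c - 1\<close>
      inside the run or by an unmoved index; the only vacated value is \<open>x\<close>, which
      \<open>lt\<close> excludes.\<close>
    proof (cases "c - 1 \<in> {x..<k}")
      case True
      then have "c - 1 \<in> D ` {1..n}" using sub by blast
      then obtain j where j: "j \<in> {1..n}" "c - 1 = D j" by blast
      then have "D' j = c" using D'[OF j(1)] True by auto
      with j show ?thesis by auto
    next
      case False
      then have "c \<noteq> k" using c lt by auto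
      with * obtain j where j: "j \<in> {1..n}" "c = D j" by auto
      with False c lt kD have "D' j = c" using D'[OF j(1)] by auto
      with j(1) show ?thesis by blast
    qed
  qed
  moreover have "D' j < c \<longleftrightarrow> - a (- int j) < c"
    if "c \<ge> a (int i)" "c \<notin> D' ` {1..n}" "j \<in> {1..n}" for c j
  proof -
    have "c \<notin> D ` {1..n}" using mem that by blast
    moreover from this have "D j < c \<longleftrightarrow> - a (- int j) < c" using IH that lt by auto
    \<comment> \<open>A move by at most one can cross the level \<open>c\<close> only by landing on
      it.\<close>
    moreover have "D' j \<noteq> c" using that by auto
    ultimately show ?thesis using D'[OF that(3)] by auto
  qed
  moreover have "{i<..m} = insert (Suc i) {Suc i<..m}" using step by auto
  ultimately show ?case
    using IH lt by (simp add: D'_def[symmetric] k_def[symmetric] ) (metis less_imp_le order_trans)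
qed

text \<open>The left side is the epsilon-coordinate of row i on arrival at column j, the right side
  the negated delta-coordinate of column j on arrival at row i. In this form the arrows are compared
  with the vanishing condition of an odd reflection.\<close>

lemma arrow_cell_iff:
  fixes a :: "int \<Rightarrow> int"
  assumes a: "\<And>i j. 1 \<le> i \<Longrightarrow> i < j \<Longrightarrow> j \<le> m \<Longrightarrow> a (int j) < a (int i)"
    and d: "\<And>i j. 1 \<le> i \<Longrightarrow> i < j \<Longrightarrow> j \<le> n \<Longrightarrow> a (- int j) < a (- int i)"
    and "i \<in> {1..m}" "j \<in> {1..n}"
  shows "arrow_cell m n a i j \<longleftrightarrow>
    a (int i) + int (card {l \<in> {1..<j}. arrow_cell m n a i l}) =
      - a (- int j) + int (card {k \<in> {i<..m}. arrow_cell m n a k j})"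
  using shifted_coord_invariant[of m a n i] assms
    arrow_row_insertion(2)[of n m a i j] unfolding shifted_coord_def by auto

subsection \<open>Singular vectors and odd reflections\<close>

definition matrix_unit :: "nat \<Rightarrow> nat \<Rightarrow> nat \<Rightarrow> complex mat" where
  "matrix_unit N r s = mat N N (\<lambda>p. if p = (r, s) then 1 else 0)"

lemma matrix_unit_carrier [simp]: "matrix_unit N r s \<in> carrier_mat N N"
  by (simp add: matrix_unit_def)

lemma dim_matrix_unit [simp]: "dim_row (matrix_unit N r s) = N" "dim_col (matrix_unit N r s) = N"
  by (simp_all add: matrix_unit_def)

lemma index_matrix_unit [simp]:
  "i < N \<Longrightarrow> j < N \<Longrightarrow> matrix_unit N r s $$ (i, j) = (if i = r \<and> j = s then 1 else 0)"
  by (simp add: matrix_unit_def)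

lemma matrix_unit_mult:
  assumes "s < N"
  shows "matrix_unit N r s * matrix_unit N t u = (if s = t then matrix_unit N r u else 0\<^sub>m N N)"
proof (rule eq_matI)
  fix i j assume ij: "i < dim_row (if s = t then matrix_unit N r u else 0\<^sub>m N N)"
    "j < dim_col (if s = t then matrix_unit N r u else 0\<^sub>m N N)"
  then have ij: "i < N" "j < N" by (auto split: if_splits)
  then have "(matrix_unit N r s * matrix_unit N t u) $$ (i, j) =
      (\<Sum>k = 0..<N. matrix_unit N r s $$ (i, k) * matrix_unit N t u $$ (k, j))"
    by (simp add: scalar_prod_def)
  also have "\<dots> = (\<Sum>k = 0..<N. if k = s then (if i = r \<and> s = t \<and> j = u then 1 else 0) else 0)"
    using ij by (intro sum.cong) auto
  also have "\<dots> = (if i = r \<and> s = t \<and> j = u then 1 else 0)"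
    using assms by simp
  finally show "(matrix_unit N r s * matrix_unit N t u) $$ (i, j) =
      (if s = t then matrix_unit N r u else 0\<^sub>m N N) $$ (i, j)"
    using ij by simp
qed auto

lemma matrix_unit_part: "matrix_unit (m + n) r s \<in> gl_part m n (of_bool ((r < m) \<noteq> (s < m)))"
  by (auto simp: gl_part_def gl_carrier_def)

context gl_supermodule
begin

definition E :: "nat \<Rightarrow> nat \<Rightarrow> 'v \<Rightarrow> 'v" where
  "E r s = act (matrix_unit (m + n) r s)"

lemma E_add: "E r s (v + w) = E r s v + E r s w"
  by (simp add: E_def act_add_right gl_carrier_def)

lemma E_scale: "E r s (scale c v) = scale c (E r s v)"
  by (simp add: E_def act_scale_right gl_carrier_def)

lemma E_zero: "E r s 0 = 0"
  using E_scale[of r s 0 0] by simp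

lemma E_sum: "E r s (\<Sum>i\<in>I. f i) = (\<Sum>i\<in>I. E r s (f i))"
  by (induction I rule: infinite_finite_induct) (simp_all add: E_add E_zero)

lemma E_parity: "v \<in> V q \<Longrightarrow> E r s v \<in> V (of_bool ((r < m) \<noteq> (s < m)) + q)"
  unfolding E_def by (rule act_parity[OF matrix_unit_part])

lemma act_zero_mat: "act (0\<^sub>m (m + n) (m + n)) v = 0"
  using act_scale_left[of "0\<^sub>m (m + n) (m + n)" 0 v] by (simp add: gl_carrier_def)

definition exch_sign :: "nat \<Rightarrow> nat \<Rightarrow> nat \<Rightarrow> nat \<Rightarrow> complex" where
  "exch_sign r s t u = super_sign (of_bool ((r < m) \<noteq> (s < m))) (of_bool ((t < m) \<noteq> (u < m)))"

lemma E_exchange: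
  assumes "s < m + n" "u < m + n"
  shows "E r s (E t u v) = scale (exch_sign r s t u) (E t u (E r s v)) +
    (if s = t then E r u v else 0) - scale (exch_sign r s t u) (if u = r then E t s v else 0)"
proof -
  let ?N = "m + n" and ?c = "exch_sign r s t u"
  have neg: "A - c \<cdot>\<^sub>m B = A + (- c) \<cdot>\<^sub>m B"
    if "A \<in> carrier_mat ?N ?N" "B \<in> carrier_mat ?N ?N" for A B and c :: complex
    using that by (intro eq_matI) auto
  have car: "(if P then matrix_unit ?N i j else 0\<^sub>m ?N ?N) \<in> carrier_mat ?N ?N" for P i j
    by simp
  have actif: "act (if P then matrix_unit ?N i j else 0\<^sub>m ?N ?N) v = (if P then E i j v else 0)" for P i j
    by (simp add: act_zero_mat E_def)
  have "E r s (E t u v) - scale ?c (E t u (E r s v)) =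
      act (matrix_unit ?N r s * matrix_unit ?N t u -
           ?c \<cdot>\<^sub>m (matrix_unit ?N t u * matrix_unit ?N r s)) v"
    using act_superbracket[OF matrix_unit_part matrix_unit_part, of r s t u v]
    by (simp add: E_def exch_sign_def superbracket_def)
  also have "\<dots> = (if s = t then E r u v else 0) - scale ?c (if u = r then E t s v else 0)"
    unfolding matrix_unit_mult[OF assms(1)] matrix_unit_mult[OF assms(2)] neg[OF car car]
    by (subst act_add_left) (auto simp: act_scale_left actif gl_carrier_def)
  finally show ?thesis by (simp add: algebra_simps)
qed

lemma act_expand:
  assumes "x \<in> gl_carrier m n"
  shows "act x v = (\<Sum>r<m + n. \<Sum>s<m + n. scale (x $$ (r, s)) (E r s v))"
proof -
  let ?N = "m + n"
  have "act (mat ?N ?N (\<lambda>p. if p \<in> F then x $$ p else 0)) v =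
      (\<Sum>p\<in>F. scale (x $$ p) (E (fst p) (snd p) v))" if "finite F" for F
    using that
  proof induction
    case empty
    have "mat ?N ?N (\<lambda>p. if p \<in> {} then x $$ p else 0) = 0\<^sub>m ?N ?N" by (intro eq_matI) auto
    then show ?case by (simp add: act_zero_mat)
  next
    case (insert q F)
    have "mat ?N ?N (\<lambda>p. if p \<in> insert q F then x $$ p else 0) =
        x $$ q \<cdot>\<^sub>m matrix_unit ?N (fst q) (snd q) + mat ?N ?N (\<lambda>p. if p \<in> F then x $$ p else 0)"
      using insert.hyps by (intro eq_matI) auto
    then show ?case using insert
      by (simp add: act_add_left act_scale_left gl_carrier_def E_def)
  qed
  from this[of "{..<?N} \<times> {..<?N}"]
  have "act (mat ?N ?N (\<lambda>p. if p \<in> {..<?N} \<times> {..<?N} then x $$ p else 0)) v =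
      (\<Sum>r<?N. \<Sum>s<?N. scale (x $$ (r, s)) (E r s v))"
    by (simp add: sum.cartesian_product case_prod_beta)
  moreover have "mat ?N ?N (\<lambda>p. if p \<in> {..<?N} \<times> {..<?N} then x $$ p else 0) = x"
    using assms by (intro eq_matI) (auto simp: gl_carrier_def)
  ultimately show ?thesis by simp
qed

lemma V_components_zero:
  assumes "a \<in> V p" "b \<in> V (p + 1)" "a + b = 0"
  shows "a = 0" "b = 0"
proof -
  have "b = - a" using assms(3) by (simp add: eq_neg_iff_add_eq_0 add.commute)
  then have "a \<in> V (p + 1)" using assms(2) subspace_neg[OF subspace_V, of b] by simp
  then have "a \<in> V 0 \<inter> V 1" using assms(1) by (cases p) auto
  then show "a = 0" using V_Int by auto
  with \<open>b = - a\<close> show "b = 0" by simp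
qed

text \<open>A total order of the rows is encoded by an injective position function; the positive roots
  are then the differences of the weights of two rows in increasing position.\<close>

definition singular :: "(nat \<Rightarrow> nat) \<Rightarrow> (nat \<Rightarrow> complex) \<Rightarrow> 'v \<Rightarrow> bool" where
  "singular pos \<mu> v \<longleftrightarrow> v \<noteq> 0 \<and> (\<forall>r<m + n. E r r v = scale (\<mu> r) v) \<and>
     (\<forall>r<m + n. \<forall>s<m + n. pos r < pos s \<longrightarrow> E r s v = 0)"

text \<open>Simplicity concerns graded submodules, so a generator has to be homogeneous. The
  conditions on a singular vector pass to its parity components because every \<open>E r s\<close>
  either preserves or exchanges the two components of the module.\<close>

lemma singular_homogeneous:
  assumes "singular pos \<mu> v"
  obtains p w where "w \<in> V p" "singular pos \<mu> w"
proof -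
  obtain a b where ab: "a \<in> V 0" "b \<in> V 1" "v = a + b" using V_sum by blast
  have diag: "E r r a = scale (\<mu> r) a \<and> E r r b = scale (\<mu> r) b" if "r < m + n" for r
  proof -
    have "E r r a - scale (\<mu> r) a \<in> V 0" "E r r b - scale (\<mu> r) b \<in> V (0 + 1)"
      using ab E_parity[of a 0 r r] E_parity[of b 1 r r]
      by (auto intro!: subspace_diff[OF subspace_V] subspace_scale[OF subspace_V])
    moreover have "(E r r a - scale (\<mu> r) a) + (E r r b - scale (\<mu> r) b) = 0"
      using assms that unfolding singular_def ab(3)
      by (simp add: E_add scale_right_distrib algebra_simps)
    ultimately show ?thesis using V_components_zero by (metis eq_iff_diff_eq_0)
  qed
  have upper: "E r s a = 0 \<and> E r s b = 0" if "r < m + n" "s < m + n" "pos r < pos s" for r s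
  proof -
    have "E r s a \<in> V (of_bool ((r < m) \<noteq> (s < m)))"
         "E r s b \<in> V (of_bool ((r < m) \<noteq> (s < m)) + 1)"
      using ab E_parity[of a 0 r s] E_parity[of b 1 r s] by auto
    moreover have "E r s a + E r s b = 0"
      using assms that unfolding singular_def ab(3) by (simp add: E_add)
    ultimately show ?thesis using V_components_zero by blast
  qed
  have "a \<noteq> 0 \<or> b \<noteq> 0" using assms ab by (auto simp: singular_def)
  then have "singular pos \<mu> a \<or> singular pos \<mu> b"
    using diag upper by (auto simp: singular_def)
  then show ?thesis using that ab by blast
qed

section \<open>The submodule generated by a singular vector\<close>

inductive_set lowered :: "(nat \<Rightarrow> nat) \<Rightarrow> 'v \<Rightarrow> 'v set" for pos v where
  base: "v \<in> lowered pos v"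
| add: "x \<in> lowered pos v \<Longrightarrow> y \<in> lowered pos v \<Longrightarrow> x + y \<in> lowered pos v"
| scale: "x \<in> lowered pos v \<Longrightarrow> scale c x \<in> lowered pos v"
| lower: "x \<in> lowered pos v \<Longrightarrow> r < m + n \<Longrightarrow> s < m + n \<Longrightarrow> pos s < pos r \<Longrightarrow>
    E r s x \<in> lowered pos v"

lemma lowered_zero: "0 \<in> lowered pos v"
  using lowered.scale[OF lowered.base, of 0] by simp

lemma subspace_lowered: "subspace (lowered pos v)"
  by (auto intro!: subspaceI lowered_zero lowered.add lowered.scale)

text \<open>\<open>lowered pos v\<close> is U(n^-)v for the order given by \<open>pos\<close>.
  Stability under upper and diagonal operators is the elementary half of the PBW argument: the
  operator is moved to the right past one lowering operator at a time, and the superbracket consists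
  of matrix units acting on a shorter expression. On \<open>v\<close> itself the result is a
  multiple of \<open>v\<close> or zero.\<close>

lemma lowered_upper:
  assumes pos: "inj_on pos {..<m + n}" and v: "singular pos \<mu> v"
    and "x \<in> lowered pos v" "r < m + n" "s < m + n" "pos r \<le> pos s"
  shows "E r s x \<in> lowered pos v"
  using assms(3-)
proof (induction arbitrary: r s)
  case base
  then show ?case
  proof (cases "r = s")
    case True
    then show ?thesis using v base by (auto simp: singular_def intro: lowered.intros)
  next
    case False
    then have "pos r \<noteq> pos s" using base inj_onD[OF pos, of r s] by auto
    with base have "pos r < pos s" by simp
    then show ?thesis using v base by (auto simp: singular_def lowered_zero)
  qed
next
  case (add x y)
  then show ?case by (simp add: E_add lowered.add)
next
  case (scale x c)
  then show ?case by (simp add: E_scale lowered.scale)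
next
  case (lower x t u)
  have all: "E i j x \<in> lowered pos v" if "i < m + n" "j < m + n" for i j
    using lower that by (cases "pos i \<le> pos j") (auto intro: lowered.lower)
  then have "E t u (E r s x) \<in> lowered pos v"
    using lower.hyps lower.prems by (intro lowered.lower[of "E r s x"]) auto
  with all show ?case using lower.hyps lower.prems
    by (subst E_exchange)
      (auto intro!: subspace_diff[OF subspace_lowered] lowered.add lowered.scale lowered_zero)
qed

lemma lowered_closed:
  assumes "inj_on pos {..<m + n}" "singular pos \<mu> v" "x \<in> lowered pos v" "r < m + n" "s < m + n"
  shows "E r s x \<in> lowered pos v"
  using assms lowered_upper by (cases "pos r \<le> pos s") (auto intro: lowered.lower)

lemma lowered_graded:
  assumes "v \<in> V p" "x \<in> lowered pos v"
  shows "\<exists>a\<in>lowered pos v \<inter> V 0. \<exists>b\<in>lowered pos v \<inter> V 1. x = a + b"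
  using assms(2)
proof induction
  case base
  show ?case
  proof (cases p)
    case zero
    then have "v \<in> V 0" using assms by simp
    then show ?thesis using subspace_0[OF subspace_V, of 1]
      by (intro bexI[of _ v] bexI[of _ 0]) (auto intro: lowered.base lowered_zero)
  next
    case one
    then have "v \<in> V 1" using assms by simp
    then show ?thesis using subspace_0[OF subspace_V, of 0]
      by (intro bexI[of _ v] bexI[of _ 0]) (auto intro: lowered.base lowered_zero)
  qed
next
  case (add x y)
  then obtain a b a' b' where "a \<in> lowered pos v \<inter> V 0" "b \<in> lowered pos v \<inter> V 1" "x = a + b"
    "a' \<in> lowered pos v \<inter> V 0" "b' \<in> lowered pos v \<inter> V 1" "y = a' + b'" by blast
  then show ?case
    by (intro bexI[of _ "a + a'"] bexI[of _ "b + b'"])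
      (auto intro: lowered.add subspace_add[OF subspace_V] simp: algebra_simps)
next
  case (scale x c)
  then obtain a b where "a \<in> lowered pos v \<inter> V 0" "b \<in> lowered pos v \<inter> V 1" "x = a + b" by blast
  then show ?case
    by (intro bexI[of _ "scale c a"] bexI[of _ "scale c b"])
      (auto intro: lowered.scale subspace_scale[OF subspace_V] simp: scale_right_distrib)
next
  case (lower x r s)
  then obtain a b where ab: "a \<in> lowered pos v \<inter> V 0" "b \<in> lowered pos v \<inter> V 1" "x = a + b" by blast
  then have low: "E r s a \<in> lowered pos v" "E r s b \<in> lowered pos v"
    using lower by (auto intro: lowered.lower)
  have E: "E r s x = E r s a + E r s b" "E r s x = E r s b + E r s a"
    using ab by (simp_all add: E_add)
  show ?case
  proof (cases "(r < m) = (s < m)")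
    case True
    then have "E r s a \<in> V 0" "E r s b \<in> V 1"
      using ab E_parity[of a 0 r s] E_parity[of b 1 r s] by auto
    then show ?thesis using low E by blast
  next
    case False
    then have "E r s a \<in> V 1" "E r s b \<in> V 0"
      using ab E_parity[of a 0 r s] E_parity[of b 1 r s] by auto
    then show ?thesis using low E by blast
  qed
qed

lemma lowered_UNIV:
  assumes "simple" "inj_on pos {..<m + n}" "singular pos \<mu> v" "v \<in> V p"
  shows "lowered pos v = UNIV"
proof -
  have "act x w \<in> lowered pos v" if "x \<in> gl_carrier m n" "w \<in> lowered pos v" for x w
    unfolding act_expand[OF that(1)]
    by (intro subspace_sum[OF subspace_lowered] lowered.scale lowered_closed[OF assms(2,3) that(2)]) auto
  then have "subsupermodule (lowered pos v)"
    using subspace_lowered lowered_graded[OF assms(4)] by (auto simp: subsupermodule_def)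
  moreover have "lowered pos v \<noteq> {0}"
    using lowered.base[of v pos] assms(3) by (auto simp: singular_def)
  ultimately show ?thesis using assms(1) by (auto simp: simple_def)
qed

text \<open>The Cartan element with diagonal entries \<open>pos r\<close>. A lowering operator
  \<open>E t u\<close> raises its eigenvalue by the positive integer \<open>pos t - pos u\<close>,
  so this one operator separates the generator from everything obtained from it by lowering.\<close>

definition height_op :: "(nat \<Rightarrow> nat) \<Rightarrow> 'v \<Rightarrow> 'v" where
  "height_op pos v = (\<Sum>r<m + n. scale (of_nat (pos r)) (E r r v))"

lemma height_op_add: "height_op pos (v + w) = height_op pos v + height_op pos w"
  by (simp add: height_op_def E_add scale_right_distrib sum.distrib)

lemma height_op_scale: "height_op pos (scale c v) = scale c (height_op pos v)"
  by (simp add: height_op_def E_scale scale_sum_right mult.commute)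

lemma height_op_E:
  assumes "t < m + n" "u < m + n"
  shows "height_op pos (E t u v) =
    E t u (height_op pos v) + scale (of_nat (pos t) - of_nat (pos u)) (E t u v)"
proof -
  have "exch_sign r r t u = 1" for r by (simp add: exch_sign_def super_sign_def)
  then have "scale (of_nat (pos r)) (E r r (E t u v)) = E t u (scale (of_nat (pos r)) (E r r v))
      + (if r = t then scale (of_nat (pos t)) (E t u v) else 0)
      - (if r = u then scale (of_nat (pos u)) (E t u v) else 0)" if "r < m + n" for r
    using that assms by (subst E_exchange)
      (auto simp: E_scale scale_right_distrib scale_right_diff_distrib)
  then have "height_op pos (E t u v) = (\<Sum>r<m + n. E t u (scale (of_nat (pos r)) (E r r v))
      + (if r = t then scale (of_nat (pos t)) (E t u v) else 0)
      - (if r = u then scale (of_nat (pos u)) (E t u v) else 0))"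
    unfolding height_op_def by (intro sum.cong) auto
  also have "\<dots> = E t u (height_op pos v) + scale (of_nat (pos t)) (E t u v)
      - scale (of_nat (pos u)) (E t u v)"
    using assms by (simp add: sum.distrib sum_subtractf height_op_def E_sum)
  finally show ?thesis by (simp add: scale_left_diff_distrib)
qed

lemma height_op_singular:
  assumes "singular pos \<mu> v"
  shows "height_op pos v = scale (\<Sum>r<m + n. of_nat (pos r) * \<mu> r) v"
  using assms by (simp add: height_op_def singular_def scale_sum_left)

text \<open>The product of the factors h - (a + i), i = 1, ..., k, for the height operator h. It
  annihilates the eigenvectors of eigenvalues a + 1, ..., a + k and acts on every other eigenvector
  by a nonzero scalar, which gives the separation of eigenspaces by hand.\<close>

primrec eigen_killer :: "(nat \<Rightarrow> nat) \<Rightarrow> complex \<Rightarrow> nat \<Rightarrow> 'v \<Rightarrow> 'v" where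
  "eigen_killer pos a 0 v = v"
| "eigen_killer pos a (Suc k) v =
     height_op pos (eigen_killer pos a k v) - scale (a + of_nat (Suc k)) (eigen_killer pos a k v)"

lemma eigen_killer_add:
  "eigen_killer pos a k (v + w) = eigen_killer pos a k v + eigen_killer pos a k w"
  by (induction k) (simp_all add: height_op_add scale_right_distrib)

lemma eigen_killer_scale: "eigen_killer pos a k (scale c v) = scale c (eigen_killer pos a k v)"
  by (induction k) (simp_all add: height_op_scale scale_right_diff_distrib mult.commute)

lemma eigen_killer_eigenvector:
  assumes "height_op pos v = scale b v"
  shows "eigen_killer pos a k v = scale (\<Prod>i = 1..k. b - (a + of_nat i)) v"
proof (induction k)
  case (Suc k)
  show ?case
    by (simp add: Suc height_op_scale assms scale_left_diff_distrib[symmetric] algebra_simps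
        del: of_nat_Suc)
qed simp

definition higher_eigenspaces :: "(nat \<Rightarrow> nat) \<Rightarrow> complex \<Rightarrow> 'v set" where
  "higher_eigenspaces pos a = span {w. \<exists>k\<ge>1. height_op pos w = scale (a + of_nat k) w}"

text \<open>An element of the span involves finitely many eigenvalues a + i, so a sufficiently long
  product has a vanishing factor for each of them.\<close>

lemma eigen_killer_higher:
  assumes "w \<in> higher_eigenspaces pos a"
  shows "\<exists>K. \<forall>k\<ge>K. eigen_killer pos a k w = 0"
  using assms unfolding higher_eigenspaces_def
proof (induction rule: span_induct_alt)
  case base
  show ?case using eigen_killer_scale[of pos a _ 0 0] by simp
next
  case (step c x y)
  then obtain i K where i: "i \<ge> 1" "height_op pos x = scale (a + of_nat i) x"
    and K: "\<forall>k\<ge>K. eigen_killer pos a k y = 0" by blast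
  have "eigen_killer pos a k x = 0" if "k \<ge> i" for k
  proof -
    have "(\<Prod>j = 1..k. (a + of_nat i) - (a + of_nat j)) = 0"
      using i that by (intro prod_zero) auto
    then show ?thesis using eigen_killer_eigenvector[OF i(2), of a k] by simp
  qed
  then show ?case using K
    by (intro exI[of _ "max i K"]) (auto simp: eigen_killer_add eigen_killer_scale)
qed

lemma higher_eigenspaces_lower:
  assumes "w \<in> higher_eigenspaces pos a" "t < m + n" "u < m + n" "pos u < pos t"
  shows "E t u w \<in> higher_eigenspaces pos a"
  using assms(1) unfolding higher_eigenspaces_def
proof (induction rule: span_induct_alt)
  case base
  show ?case by (simp add: E_zero span_zero)
next
  case (step c x y)
  then obtain i where i: "i \<ge> 1" "height_op pos x = scale (a + of_nat i) x" by blast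
  have "height_op pos (E t u x) = scale (a + of_nat (i + (pos t - pos u))) (E t u x)"
    using assms(4) by (simp only: height_op_E[OF assms(2,3)] i(2) E_add E_scale of_nat_diff less_imp_le
        of_nat_add scale_left_distrib add.assoc)
  moreover have "i + (pos t - pos u) \<ge> 1" using i by simp
  ultimately have "E t u x \<in> span {w. \<exists>k\<ge>1. height_op pos w = scale (a + of_nat k) w}"
    by (intro span_base) blast
  with step show ?case by (simp add: E_add E_scale span_add span_scale)
qed

lemma lowered_decomposition:
  assumes v: "singular pos \<mu> v" and a: "a = (\<Sum>r<m + n. of_nat (pos r) * \<mu> r)"
    and "x \<in> lowered pos v"
  shows "\<exists>c. \<exists>q\<in>higher_eigenspaces pos a. x = scale c v + q"
  using assms(3)
proof induction
  case base
  show ?case by (rule exI[of _ 1], rule bexI[of _ 0]) (auto simp: higher_eigenspaces_def span_zero)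
next
  case (add x y)
  then obtain c q d r where "q \<in> higher_eigenspaces pos a" "x = scale c v + q"
    "r \<in> higher_eigenspaces pos a" "y = scale d v + r" by blast
  then show ?case
    by (intro exI[of _ "c + d"] bexI[of _ "q + r"])
      (auto simp: higher_eigenspaces_def scale_left_distrib algebra_simps intro: span_add)
next
  case (scale x d)
  then obtain c q where "q \<in> higher_eigenspaces pos a" "x = scale c v + q" by blast
  then show ?case
    by (intro exI[of _ "d * c"] bexI[of _ "scale d q"])
      (auto simp: higher_eigenspaces_def scale_right_distrib intro: span_scale)
next
  case (lower x r s)
  then obtain c q where q: "q \<in> higher_eigenspaces pos a" "x = scale c v + q" by blast
  have "height_op pos (E r s v) = scale (a + of_nat (pos r - pos s)) (E r s v)"
    using lower(4) by (simp only: height_op_E[OF lower(2,3)] height_op_singular[OF v, folded a]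
        E_scale of_nat_diff less_imp_le scale_left_distrib)
  then have "E r s v \<in> higher_eigenspaces pos a" unfolding higher_eigenspaces_def
    using lower by (intro span_base) (auto intro!: exI[of _ "pos r - pos s"])
  then have "scale c (E r s v) + E r s q \<in> higher_eigenspaces pos a"
    using higher_eigenspaces_lower[OF q(1) lower(2,3,4)] unfolding higher_eigenspaces_def
    by (intro span_add span_scale)
  then show ?case
    by (intro exI[of _ 0] bexI[of _ "scale c (E r s v) + E r s q"]) (auto simp: q E_add E_scale)
qed

text \<open>Write w = c v + q with q of greater height. A product that kills q turns this into d w =
  e v, where d is nonzero because the height b of w is none of a + 1, a + 2, .... Comparing the
  Cartan action on both sides gives equal weights.\<close>

lemma singular_weights_eq:
  assumes "simple" "inj_on pos {..<m + n}" and v: "singular pos \<mu> v" and w: "singular pos \<nu> w"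
    and "v \<in> V p"
    and ab: "a = (\<Sum>r<m + n. of_nat (pos r) * \<mu> r)" "b = (\<Sum>r<m + n. of_nat (pos r) * \<nu> r)"
    and neq: "\<And>k. k \<ge> 1 \<Longrightarrow> b \<noteq> a + of_nat k"
    and r: "r < m + n"
  shows "\<mu> r = \<nu> r"
proof -
  have "w \<in> lowered pos v" using lowered_UNIV[OF assms(1,2) v assms(5)] by simp
  then obtain c q where q: "q \<in> higher_eigenspaces pos a" "w = scale c v + q"
    using lowered_decomposition[OF v ab(1)] by blast
  from eigen_killer_higher[OF q(1)] obtain k where k: "eigen_killer pos a k q = 0" by blast
  define d where "d = (\<Prod>i = 1..k. b - (a + of_nat i))"
  define e where "e = c * (\<Prod>i = 1..k. a - (a + of_nat i))"
  have "scale d w = eigen_killer pos a k w"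
    using eigen_killer_eigenvector[OF height_op_singular[OF w]] by (simp add: d_def ab)
  also have "\<dots> = scale e v"
    unfolding q(2) eigen_killer_add eigen_killer_scale k
    using eigen_killer_eigenvector[OF height_op_singular[OF v]] by (simp add: e_def ab)
  finally have eq: "scale d w = scale e v" .
  have "d \<noteq> 0" using neq by (auto simp: d_def)
  have "w \<noteq> 0" using w by (simp add: singular_def)
  have "scale d (scale (\<nu> r) w) = E r r (scale d w)"
    using w r by (simp add: E_scale singular_def)
  also have "\<dots> = scale (\<mu> r) (scale e v)"
    using v r by (simp add: eq E_scale singular_def mult.commute)
  also have "\<dots> = scale d (scale (\<mu> r) w)"
    by (simp only: eq[symmetric]) (simp add: mult.commute)
  finally show ?thesis using \<open>d \<noteq> 0\<close> \<open>w \<noteq> 0\<close> by simp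
qed

text \<open>Two heights cannot each exceed the other by a positive integer, so after interchanging
  the two vectors if necessary the asymmetric comparison applies.\<close>

lemma singular_weight_unique:
  assumes "simple" "inj_on pos {..<m + n}" "singular pos \<mu> v" "singular pos \<nu> w" "r < m + n"
  shows "\<mu> r = \<nu> r"
proof -
  define a where "a = (\<Sum>r<m + n. of_nat (pos r) * \<mu> r)"
  define b where "b = (\<Sum>r<m + n. of_nat (pos r) * \<nu> r)"
  obtain p v' where v': "v' \<in> V p" "singular pos \<mu> v'" using singular_homogeneous[OF assms(3)] .
  obtain q w' where w': "w' \<in> V q" "singular pos \<nu> w'" using singular_homogeneous[OF assms(4)] .
  show ?thesis
  proof (cases "\<exists>k\<ge>1. b = a + of_nat k")
    case False
    then show ?thesis
      using singular_weights_eq[OF assms(1,2) v'(2) w'(2) v'(1) a_def b_def _ assms(5)] by blast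
  next
    case True
    then obtain k :: nat where k: "k \<ge> 1" "b = a + of_nat k" by blast
    have "a \<noteq> b + of_nat j" if "j \<ge> 1" for j :: nat
    proof
      assume "a = b + of_nat j"
      then have "of_nat (k + j) = (0 :: complex)" using k by (simp add: algebra_simps)
      then show False using k by (simp only: of_nat_eq_0_iff)
    qed
    then show ?thesis
      using singular_weights_eq[OF assms(1,2) w'(2) v'(2) w'(1) b_def a_def _ assms(5)] by metis
  qed
qed

text \<open>Since r and s are adjacent in the order, exchanging them reverses only this one pair;
  every other upper operator stays upper and must be shown to kill the new vector as well.\<close>

lemma odd_reflection:
  assumes simple and pos: "inj_on pos {..<m + n}" and v: "singular pos \<mu> v"
    and r: "r < m" and s: "m \<le> s" "s < m + n" and adj: "pos s = Suc (pos r)"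
  defines "pos' \<equiv> pos(r := pos s, s := pos r)"
  shows "\<exists>w. singular pos' (if \<mu> r + \<mu> s = 0 then \<mu> else \<mu>(r := \<mu> r - 1, s := \<mu> s + 1)) w"
proof -
  define f where "f = E s r v"
  have rs: "r < m + n" "s < m + n" "r \<noteq> s" using r s by auto
  have sgn: "exch_sign r s s r = - 1" "exch_sign s r s r = - 1"
    "exch_sign t t s r = 1" for t
    using r s by (auto simp: exch_sign_def super_sign_def)
  have ev: "E t t v = scale (\<mu> t) v" if "t < m + n" for t
    using v that by (simp add: singular_def)
  have uv: "E t u v = 0" if "t < m + n" "u < m + n" "pos t < pos u" for t u
    using v that by (simp add: singular_def)
  \<comment> \<open>The root is odd and isotropic: the superbracket of its root vector with itself
    vanishes, so \<open>E s r f\<close> equals its own negative.\<close>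
  have ff: "E s r f = 0"
  proof -
    have "E s r f = - E s r f"
      using E_exchange[of r r s s v] rs sgn by (simp add: f_def)
    then have "scale 2 (E s r f) = 0"
      by (metis add.left_inverse one_add_one scale_left_distrib scale_one)
    then show ?thesis by simp
  qed
  have ef: "E r s f = scale (\<mu> r + \<mu> s) v"
    using E_exchange[of s r r s v] rs sgn uv[of r s] adj
    by (simp add: f_def ev E_zero scale_left_distrib)
  have wt: "E t t f = scale ((\<mu>(r := \<mu> r - 1, s := \<mu> s + 1)) t) f" if "t < m + n" for t
    using E_exchange[of t r t s v] rs sgn that
    by (auto simp: f_def ev E_scale scale_left_distrib scale_left_diff_distrib)
  \<comment> \<open>Moving \<open>E t u\<close> past \<open>E s r\<close> leaves a superbracket only
    for u = s or t = r. By adjacency the operator left over, \<open>E t r\<close> or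
    \<open>E s u\<close>, is again an upper one and kills \<open>v\<close>.\<close>
  have up: "E t u f = 0" if "t < m + n" "u < m + n" "pos t < pos u" "(t, u) \<noteq> (r, s)" for t u
  proof -
    have "E t r v = 0" if "u = s"
    proof -
      have "pos t \<noteq> pos r" using inj_onD[OF pos, of t r] that \<open>(t, u) \<noteq> (r, s)\<close> \<open>t < m + n\<close> rs by auto
      then show ?thesis using uv[of t r] that \<open>t < m + n\<close> \<open>pos t < pos u\<close> rs adj by auto
    qed
    moreover have "E s u v = 0" if "t = r"
    proof -
      have "pos u \<noteq> pos s" using inj_onD[OF pos, of u s] that \<open>(t, u) \<noteq> (r, s)\<close> \<open>u < m + n\<close> rs by auto
      then show ?thesis using uv[of s u] that \<open>u < m + n\<close> \<open>pos t < pos u\<close> rs adj by auto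
    qed
    ultimately show ?thesis
      using E_exchange[of u r t s v] that rs uv[of t u] by (auto simp: f_def E_zero)
  qed
  have pos': "pos t < pos u \<and> (t, u) \<noteq> (r, s) \<or> (t, u) = (s, r)"
    if "t < m + n" "u < m + n" "pos' t < pos' u" for t u
  proof -
    have "pos t = pos r \<longleftrightarrow> t = r" "pos t = pos s \<longleftrightarrow> t = s"
      "pos u = pos r \<longleftrightarrow> u = r" "pos u = pos s \<longleftrightarrow> u = s"
      using that rs pos by (auto simp: inj_on_def)
    then show ?thesis using that(3) adj rs(3) by (auto simp: pos'_def split: if_splits)
  qed
  show ?thesis
  proof (cases "\<mu> r + \<mu> s = 0")
    case True
    have "f = 0"
    proof (rule ccontr)
      assume "f \<noteq> 0"
      have "E r s f = 0" using ef True by simp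
      with up \<open>f \<noteq> 0\<close> wt have "singular pos (\<mu>(r := \<mu> r - 1, s := \<mu> s + 1)) f"
        by (auto simp: singular_def)
      from singular_weight_unique[OF \<open>simple\<close> pos v this, of r] rs show False by simp
    qed
    then have "E t u v = 0" if "t < m + n" "u < m + n" "pos' t < pos' u" for t u
      using pos'[OF that] uv that by (auto simp: f_def)
    then have "singular pos' \<mu> v" using v by (auto simp: singular_def)
    then show ?thesis using True by auto
  next
    case False
    have "f \<noteq> 0"
      using ef v False by (auto simp: E_zero singular_def)
    moreover have "E t u f = 0" if "t < m + n" "u < m + n" "pos' t < pos' u" for t u
      using pos'[OF that] up that ff by auto
    ultimately have "singular pos' (\<mu>(r := \<mu> r - 1, s := \<mu> s + 1)) f"
      using wt by (auto simp: singular_def)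
    then show ?thesis using False by auto
  qed
qed

end

subsection \<open>Roots as differences of row weights\<close>

text \<open>Inverse to \<open>row_of m\<close> on rows. Working with rows puts epsilons and deltas
  on the same footing: every root becomes a difference of two values of \<open>row_weight\<close>,
  and its parity only asks in which blocks the two rows lie.\<close>

definition index_of :: "nat \<Rightarrow> nat \<Rightarrow> int" where
  "index_of m r = (if r < m then int r + 1 else - int (r - m) - 1)"

definition row_weight :: "nat \<Rightarrow> nat \<Rightarrow> weight" where
  "row_weight m r = (\<lambda>k. if k = index_of m r then 1 else 0)"

lemma index_of_inject: "index_of m p = index_of m q \<longleftrightarrow> p = q"
  by (auto simp: index_of_def split: if_splits)

lemma row_weight_apply: "row_weight m r (index_of m p) = (if p = r then 1 else 0)"
  by (auto simp: row_weight_def index_of_inject)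

lemma eps_row_weight: "i \<in> {1..m} \<Longrightarrow> eps i = row_weight m (i - 1)"
  by (auto simp: eps_def row_weight_def index_of_def fun_eq_iff)

lemma del_row_weight: "j \<ge> 1 \<Longrightarrow> del j = row_weight m (m + j - 1)"
  by (auto simp: del_def row_weight_def index_of_def fun_eq_iff)

lemma row_weight_eps: "r < m \<Longrightarrow> row_weight m r = eps (r + 1)"
  by (simp add: eps_row_weight[of _ m])

lemma row_weight_del: "m \<le> r \<Longrightarrow> row_weight m r = del (r - m + 1)"
  by (simp add: del_row_weight[of _ m])

lemma row_of_index_of: "row_of m (index_of m r) = r"
  by (auto simp: row_of_def index_of_def)

lemma bij_betw_index_of: "bij_betw (index_of m) {..<m + n} (indices m n)"
proof (rule bij_betw_imageI)
  show "inj_on (index_of m) {..<m + n}" by (auto simp: inj_on_def index_of_inject)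
  have "k \<in> index_of m ` {..<m + n}" if "k \<in> indices m n" for k
    using that
    by (intro image_eqI[of _ _ "row_of m k"]) (auto simp: indices_def index_of_def row_of_def)
  moreover have "index_of m r \<in> indices m n" if "r < m + n" for r
    using that by (auto simp: indices_def index_of_def)
  ultimately show "index_of m ` {..<m + n} = indices m n" by blast
qed

lemma weight_eval_rows:
  "weight_eval m n \<nu> h = (\<Sum>r<m + n. \<nu> (index_of m r) * h $$ (r, r))"
  unfolding weight_eval_def
  by (subst sum.reindex_bij_betw[OF bij_betw_index_of, symmetric]) (simp add: row_of_index_of)

lemma row_weight_diff_eq_iff:
  assumes "p \<noteq> q" "p' \<noteq> q'"
  shows "row_weight m p - row_weight m q = row_weight m p' - row_weight m q' \<longleftrightarrow> p = p' \<and> q = q'"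
proof
  assume eq: "row_weight m p - row_weight m q = row_weight m p' - row_weight m q'"
  have "row_weight m p (index_of m t) - row_weight m q (index_of m t) =
      row_weight m p' (index_of m t) - row_weight m q' (index_of m t)" for t
    using fun_cong[OF eq, of "index_of m t"] by simp
  from this[of p] this[of q] show "p = p' \<and> q = q'"
    using assms by (auto simp: row_weight_apply split: if_splits)
qed simp

lemma row_weight_diff_nonzero: "p \<noteq> q \<Longrightarrow> row_weight m p - row_weight m q \<noteq> 0"
  by (metis row_weight_diff_eq_iff minus_diff_eq neg_0_equal_iff_equal)

lemma right_odd_roots_rows:
  "right_odd_roots m n = {row_weight m p - row_weight m q | p q. p < m \<and> m \<le> q \<and> q < m + n}"
proof (intro Set.set_eqI iffI)
  fix x assume "x \<in> right_odd_roots m n"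
  then obtain i j where "x = eps i - del j" "i \<in> {1..m}" "j \<in> {1..n}"
    by (auto simp: right_odd_roots_def)
  then show "x \<in> {row_weight m p - row_weight m q | p q. p < m \<and> m \<le> q \<and> q < m + n}"
    by (intro CollectI exI[of _ "i - 1"] exI[of _ "m + j - 1"])
      (auto simp: eps_row_weight del_row_weight[of _ m])
next
  fix x assume "x \<in> {row_weight m p - row_weight m q | p q. p < m \<and> m \<le> q \<and> q < m + n}"
  then obtain p q where "x = row_weight m p - row_weight m q" "p < m" "m \<le> q" "q < m + n" by blast
  then show "x \<in> right_odd_roots m n" unfolding right_odd_roots_def
    by (intro CollectI exI[of _ "p + 1"] exI[of _ "q - m + 1"])
      (auto simp: row_weight_eps row_weight_del)
qed

lemma even_roots_rows:
  "even_roots m n = {row_weight m p - row_weight m q | p q.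
     p < m + n \<and> q < m + n \<and> p \<noteq> q \<and> (p < m \<longleftrightarrow> q < m)}" (is "_ = ?R")
proof (intro Set.set_eqI iffI)
  fix x assume "x \<in> even_roots m n"
  then consider i j where "x = eps i - eps j" "i \<in> {1..m}" "j \<in> {1..m}" "i \<noteq> j"
    | i j where "x = del i - del j" "i \<in> {1..n}" "j \<in> {1..n}" "i \<noteq> j"
    by (auto simp: even_roots_def)
  then show "x \<in> ?R"
  proof cases
    case 1
    then show ?thesis
      by (intro CollectI exI[of _ "i - 1"] exI[of _ "j - 1"]) (auto simp: eps_row_weight)
  next
    case 2
    then show ?thesis
      by (intro CollectI exI[of _ "m + i - 1"] exI[of _ "m + j - 1"]) (auto simp: del_row_weight[of _ m])
  qed
next
  fix x assume "x \<in> ?R"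
  then obtain p q where x: "x = row_weight m p - row_weight m q"
    and pq: "p < m + n" "q < m + n" "p \<noteq> q" "p < m \<longleftrightarrow> q < m" by blast
  show "x \<in> even_roots m n"
  proof (cases "p < m")
    case True
    then have "x = eps (p + 1) - eps (q + 1)" using x pq by (simp add: row_weight_eps)
    then show ?thesis using True pq unfolding even_roots_def
      by (intro UnI1 CollectI exI[of _ "p + 1"] exI[of _ "q + 1"]) auto
  next
    case False
    then have "x = del (p - m + 1) - del (q - m + 1)" using x pq by (simp add: row_weight_del)
    then show ?thesis using False pq unfolding even_roots_def
      by (intro UnI2 CollectI exI[of _ "p - m + 1"] exI[of _ "q - m + 1"]) auto
  qed
qed

lemma odd_roots_rows:
  "odd_roots m n = {row_weight m p - row_weight m q | p q.
     p < m + n \<and> q < m + n \<and> (p < m \<longleftrightarrow> \<not> q < m)}" (is "_ = ?R")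
proof (intro Set.set_eqI iffI)
  fix x assume "x \<in> odd_roots m n"
  then consider "x \<in> right_odd_roots m n" | "- x \<in> right_odd_roots m n"
    by (auto simp: odd_roots_def)
  then show "x \<in> ?R"
  proof cases
    case 1
    then show ?thesis unfolding right_odd_roots_rows by force
  next
    case 2
    then obtain p q where "- x = row_weight m p - row_weight m q" "p < m" "m \<le> q" "q < m + n"
      unfolding right_odd_roots_rows by blast
    moreover from this(1) have "x = row_weight m q - row_weight m p" by (metis minus_diff_eq minus_minus)
    ultimately show ?thesis by (intro CollectI exI[of _ q] exI[of _ p]) auto
  qed
next
  fix x assume "x \<in> ?R"
  then obtain p q where x: "x = row_weight m p - row_weight m q"
    and pq: "p < m + n" "q < m + n" "p < m \<longleftrightarrow> \<not> q < m" by blast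
  show "x \<in> odd_roots m n"
  proof (cases "p < m")
    case True
    then show ?thesis using x pq unfolding odd_roots_def right_odd_roots_rows by auto
  next
    case False
    then have "row_weight m q - row_weight m p \<in> right_odd_roots m n"
      using pq unfolding right_odd_roots_rows by (intro CollectI exI[of _ q] exI[of _ p]) auto
    then have "- (row_weight m q - row_weight m p) \<in> odd_roots m n"
      unfolding odd_roots_def by blast
    then show ?thesis using x by simp
  qed
qed

lemma roots_rows:
  "roots m n = {row_weight m p - row_weight m q | p q. p < m + n \<and> q < m + n \<and> p \<noteq> q}"
  unfolding roots_def even_roots_rows odd_roots_rows by blast

lemma finite_roots: "finite (roots m n)"
proof -
  have "roots m n \<subseteq> (\<lambda>(p, q). row_weight m p - row_weight m q) ` ({..<m + n} \<times> {..<m + n})"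
    unfolding roots_rows by auto
  then show ?thesis by (rule finite_subset) simp
qed

definition ordered_roots :: "nat \<Rightarrow> nat \<Rightarrow> (nat \<Rightarrow> nat) \<Rightarrow> weight set" where
  "ordered_roots m n pos =
     {row_weight m p - row_weight m q | p q. p < m + n \<and> q < m + n \<and> pos p < pos q}"

lemma ordered_roots_iff:
  assumes "p < m + n" "q < m + n" "p \<noteq> q"
  shows "row_weight m p - row_weight m q \<in> ordered_roots m n pos \<longleftrightarrow> pos p < pos q"
proof
  assume "row_weight m p - row_weight m q \<in> ordered_roots m n pos"
  then obtain p' q' where *: "row_weight m p - row_weight m q = row_weight m p' - row_weight m q'"
    "pos p' < pos q'" by (auto simp: ordered_roots_def)
  then have "p' \<noteq> q'" by auto
  with * show "pos p < pos q" using row_weight_diff_eq_iff[OF assms(3)] by blast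
qed (use assms in \<open>auto simp: ordered_roots_def\<close>)

section \<open>Root spaces and highest weight vectors\<close>

lemma matrix_unit_root_space:
  assumes "p < m + n" "q < m + n"
  shows "matrix_unit (m + n) p q \<in> root_space m n (row_weight m p - row_weight m q)"
proof -
  let ?N = "m + n"
  have "h * matrix_unit ?N p q - matrix_unit ?N p q * h =
      weight_eval m n (row_weight m p - row_weight m q) h \<cdot>\<^sub>m matrix_unit ?N p q"
    if h: "h \<in> cartan m n" for h
  proof -
    have hc: "h \<in> carrier_mat ?N ?N" and d: "\<And>i j. i < ?N \<Longrightarrow> j < ?N \<Longrightarrow> i \<noteq> j \<Longrightarrow> h $$ (i, j) = 0"
      using h by (auto simp: cartan_def gl_carrier_def diagonal_mat_def)
    have ev: "weight_eval m n (row_weight m p - row_weight m q) h = h $$ (p, p) - h $$ (q, q)"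
      using assms by (simp add: weight_eval_rows row_weight_apply left_diff_distrib sum_subtractf
          if_distrib[of "\<lambda>x. x * _"] cong: if_cong)
    show ?thesis
    proof (rule eq_matI)
      fix i j assume "i < dim_row (weight_eval m n (row_weight m p - row_weight m q) h \<cdot>\<^sub>m matrix_unit ?N p q)"
        "j < dim_col (weight_eval m n (row_weight m p - row_weight m q) h \<cdot>\<^sub>m matrix_unit ?N p q)"
      then have ij: "i < ?N" "j < ?N" by auto
      have "(h * matrix_unit ?N p q) $$ (i, j) = (\<Sum>k = 0..<?N. h $$ (i, k) * matrix_unit ?N p q $$ (k, j))"
        using ij hc by (simp add: scalar_prod_def)
      also have "\<dots> = (\<Sum>k = 0..<?N. if k = p then (if i = p \<and> j = q then h $$ (p, p) else 0) else 0)"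
        using ij d assms by (intro sum.cong) auto
      finally have 1: "(h * matrix_unit ?N p q) $$ (i, j) = (if i = p \<and> j = q then h $$ (p, p) else 0)"
        using assms by simp
      have "(matrix_unit ?N p q * h) $$ (i, j) = (\<Sum>k = 0..<?N. matrix_unit ?N p q $$ (i, k) * h $$ (k, j))"
        using ij hc by (simp add: scalar_prod_def)
      also have "\<dots> = (\<Sum>k = 0..<?N. if k = q then (if i = p \<and> j = q then h $$ (q, q) else 0) else 0)"
        using ij d assms by (intro sum.cong) auto
      finally have 2: "(matrix_unit ?N p q * h) $$ (i, j) = (if i = p \<and> j = q then h $$ (q, q) else 0)"
        using assms by simp
      show "(h * matrix_unit ?N p q - matrix_unit ?N p q * h) $$ (i, j) =
        (weight_eval m n (row_weight m p - row_weight m q) h \<cdot>\<^sub>m matrix_unit ?N p q) $$ (i, j)"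
        using ij hc by (simp add: 1 2 ev del: index_mult_mat(1))
    qed (use hc in auto)
  qed
  then show ?thesis by (simp add: root_space_def gl_carrier_def)
qed

text \<open>Testing with the diagonal matrix unit at t compares how often t occurs in the pairs (i,
  j) and (p, q), with sign. The choices t = p and t = q already force i = p and j = q, so a root
  space is spanned by a single matrix unit.\<close>

lemma root_space_entries:
  assumes x: "x \<in> root_space m n (row_weight m p - row_weight m q)"
    and pq: "p < m + n" "q < m + n" "p \<noteq> q" and ij: "i < m + n" "j < m + n"
    and nz: "x $$ (i, j) \<noteq> 0"
  shows "i = p \<and> j = q"
proof -
  let ?N = "m + n"
  have xc: "x \<in> carrier_mat ?N ?N" using x by (simp add: root_space_def gl_carrier_def)
  have key: "(if i = t then 1 else 0) - (if j = t then 1 else 0) =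
      (if t = p then 1 else 0) - (if t = q then 1 else (0::complex))" if t: "t < ?N" for t
  proof -
    let ?h = "matrix_unit ?N t t"
    have h: "?h \<in> cartan m n" by (auto simp: cartan_def gl_carrier_def diagonal_mat_def)
    have ev: "weight_eval m n (row_weight m p - row_weight m q) ?h =
        (if t = p then 1 else 0) - (if t = q then 1 else 0)"
    proof -
      have "weight_eval m n (row_weight m p - row_weight m q) ?h =
          (\<Sum>r<?N. if r = t then (if t = p then 1 else 0) - (if t = q then 1 else 0) else 0)"
        unfolding weight_eval_rows by (intro sum.cong) (auto simp: row_weight_apply)
      then show ?thesis using t by simp
    qed
    have "(?h * x) $$ (i, j) = (\<Sum>k = 0..<?N. ?h $$ (i, k) * x $$ (k, j))"
      using ij xc by (simp add: scalar_prod_def)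
    also have "\<dots> = (\<Sum>k = 0..<?N. if k = t then (if i = t then x $$ (i, j) else 0) else 0)"
      using ij by (intro sum.cong) auto
    finally have 1: "(?h * x) $$ (i, j) = (if i = t then x $$ (i, j) else 0)" using t by simp
    have "(x * ?h) $$ (i, j) = (\<Sum>k = 0..<?N. x $$ (i, k) * ?h $$ (k, j))"
      using ij xc by (simp add: scalar_prod_def)
    also have "\<dots> = (\<Sum>k = 0..<?N. if k = t then (if j = t then x $$ (i, j) else 0) else 0)"
      using ij by (intro sum.cong) auto
    finally have 2: "(x * ?h) $$ (i, j) = (if j = t then x $$ (i, j) else 0)" using t by simp
    have "?h * x - x * ?h = weight_eval m n (row_weight m p - row_weight m q) ?h \<cdot>\<^sub>m x"
      using x h by (simp add: root_space_def)
    then have "(?h * x - x * ?h) $$ (i, j) =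
        (weight_eval m n (row_weight m p - row_weight m q) ?h \<cdot>\<^sub>m x) $$ (i, j)" by simp
    then have "(?h * x) $$ (i, j) - (x * ?h) $$ (i, j) =
        ((if t = p then 1 else 0) - (if t = q then 1 else 0)) * x $$ (i, j)"
      using ij xc by (simp add: ev del: index_mult_mat(1))
    then show ?thesis using nz unfolding 1 2 by (auto split: if_splits)
  qed
  from key[OF pq(1)] key[OF pq(2)] pq(3) show ?thesis by (auto split: if_splits)
qed

context gl_supermodule
begin

text \<open>Reduces conditions on the whole Cartan subalgebra and on all positive root spaces to
  matrix units, so that a base enters only through the order \<open>pos\<close>.\<close>

lemma has_highest_weight_iff_singular:
  assumes "positive_roots m n S = ordered_roots m n pos"
  shows "has_highest_weight S \<mu> \<longleftrightarrow>
    \<mu> \<in> weight_space_dual m n \<and> (\<exists>v. singular pos (\<lambda>r. \<mu> (index_of m r)) v)"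
proof -
  let ?N = "m + n"
  have cartan: "(\<forall>h\<in>cartan m n. act h v = scale (weight_eval m n \<mu> h) v) \<longleftrightarrow>
      (\<forall>r<?N. E r r v = scale (\<mu> (index_of m r)) v)" for v
  proof
    assume *: "\<forall>h\<in>cartan m n. act h v = scale (weight_eval m n \<mu> h) v"
    show "\<forall>r<?N. E r r v = scale (\<mu> (index_of m r)) v"
    proof (intro allI impI)
      fix r assume r: "r < ?N"
      have "matrix_unit ?N r r \<in> cartan m n"
        by (auto simp: cartan_def gl_carrier_def diagonal_mat_def)
      moreover have "weight_eval m n \<mu> (matrix_unit ?N r r) =
          (\<Sum>k<?N. if k = r then \<mu> (index_of m r) else 0)"
        unfolding weight_eval_rows by (intro sum.cong) auto
      ultimately show "E r r v = scale (\<mu> (index_of m r)) v"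
        using * r by (simp add: E_def)
    qed
  next
    assume *: "\<forall>r<?N. E r r v = scale (\<mu> (index_of m r)) v"
    show "\<forall>h\<in>cartan m n. act h v = scale (weight_eval m n \<mu> h) v"
    proof
      fix h assume h: "h \<in> cartan m n"
      then have hc: "h \<in> gl_carrier m n" and d: "\<And>i j. i < ?N \<Longrightarrow> j < ?N \<Longrightarrow> i \<noteq> j \<Longrightarrow> h $$ (i, j) = 0"
        by (auto simp: cartan_def gl_carrier_def diagonal_mat_def)
      have "(\<Sum>s<?N. scale (h $$ (r, s)) (E r s v)) = scale (\<mu> (index_of m r) * h $$ (r, r)) v"
        if "r < ?N" for r
      proof -
        have "(\<Sum>s<?N. scale (h $$ (r, s)) (E r s v)) =
            (\<Sum>s<?N. if s = r then scale (h $$ (r, r)) (E r r v) else 0)"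
          using d that by (intro sum.cong) auto
        then show ?thesis using that * by (simp add: mult.commute)
      qed
      then show "act h v = scale (weight_eval m n \<mu> h) v"
        by (simp add: act_expand[OF hc] weight_eval_rows scale_sum_left)
    qed
  qed
  have upper: "(\<forall>\<alpha>\<in>positive_roots m n S. \<forall>x\<in>root_space m n \<alpha>. act x v = 0) \<longleftrightarrow>
      (\<forall>r<?N. \<forall>s<?N. pos r < pos s \<longrightarrow> E r s v = 0)" for v
  proof
    assume "\<forall>\<alpha>\<in>positive_roots m n S. \<forall>x\<in>root_space m n \<alpha>. act x v = 0"
    then show "\<forall>r<?N. \<forall>s<?N. pos r < pos s \<longrightarrow> E r s v = 0"
      using matrix_unit_root_space unfolding E_def assms ordered_roots_def by blast
  next
    assume *: "\<forall>r<?N. \<forall>s<?N. pos r < pos s \<longrightarrow> E r s v = 0"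
    show "\<forall>\<alpha>\<in>positive_roots m n S. \<forall>x\<in>root_space m n \<alpha>. act x v = 0"
    proof (intro ballI)
      fix \<alpha> x assume "\<alpha> \<in> positive_roots m n S" and x: "x \<in> root_space m n \<alpha>"
      then obtain p q where pq: "\<alpha> = row_weight m p - row_weight m q" "p < ?N" "q < ?N" "pos p < pos q"
        unfolding assms ordered_roots_def by blast
      have "scale (x $$ (i, j)) (E i j v) = 0" if "i < ?N" "j < ?N" for i j
        using root_space_entries[of x m n p q i j] x pq that * by (cases "x $$ (i, j) = 0") auto
      then show "act x v = 0"
        using x by (subst act_expand) (auto simp: root_space_def intro!: sum.neutral)
    qed
  qed
  show ?thesis
    unfolding has_highest_weight_def singular_def cartan upper by blast
qed

end

subsection \<open>Diagrams and the bases they encode\<close>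

text \<open>The closure direction expresses transitivity: if delta_j precedes epsilon_i, then every
  earlier delta precedes every later epsilon. Diagrams therefore grow from the cell (m, 1), not from
  (1, 1).\<close>

definition diagram :: "nat \<Rightarrow> nat \<Rightarrow> (nat \<times> nat) set \<Rightarrow> bool" where
  "diagram m n B \<longleftrightarrow> B \<subseteq> {1..m} \<times> {1..n} \<and>
     (\<forall>i j i' j'. (i, j) \<in> B \<longrightarrow> i \<le> i' \<longrightarrow> i' \<le> m \<longrightarrow> 1 \<le> j' \<longrightarrow> j' \<le> j \<longrightarrow> (i', j') \<in> B)"

lemma diagram_bounds: "diagram m n B \<Longrightarrow> (i, j) \<in> B \<Longrightarrow> i \<in> {1..m} \<and> j \<in> {1..n}"
  unfolding diagram_def by blast

lemma diagram_down:
  "diagram m n B \<Longrightarrow> (i, j) \<in> B \<Longrightarrow> i \<le> i' \<Longrightarrow> i' \<le> m \<Longrightarrow> 1 \<le> j' \<Longrightarrow> j' \<le> j \<Longrightarrow> (i', j') \<in> B"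
  unfolding diagram_def by blast

lemma finite_diagram: "diagram m n B \<Longrightarrow> finite B"
  unfolding diagram_def by (rule finite_subset[of _ "{1..m} \<times> {1..n}"]) auto

definition row_length :: "(nat \<times> nat) set \<Rightarrow> nat \<Rightarrow> nat" where
  "row_length B i = card {l. (i, l) \<in> B}"

text \<open>The missing cells are counted because they correspond to the epsilons in front of
  delta_j, just as \<open>row_length\<close> counts the deltas in front of epsilon_i; a position is
  the own index plus such a count.\<close>

definition column_gap :: "nat \<Rightarrow> (nat \<times> nat) set \<Rightarrow> nat \<Rightarrow> nat" where
  "column_gap m B j = card {k \<in> {1..m}. (k, j) \<notin> B}"

text \<open>The boundary path of the diagram is a shuffle of the \<open>\<epsilon>\<close>'s and the \<open>\<delta>\<close>'s, where \<open>\<delta>\<^sub>j\<close>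
  precedes \<open>\<epsilon>\<^sub>i\<close> iff \<open>(i, j)\<close> is a cell; this is the position of a row in that shuffle.\<close>

definition shuffle_pos :: "nat \<Rightarrow> (nat \<times> nat) set \<Rightarrow> nat \<Rightarrow> nat" where
  "shuffle_pos m B r =
     (if r < m then r + 1 + row_length B (r + 1) else r - m + 1 + column_gap m B (r - m + 1))"

context
  fixes m n :: nat and B :: "(nat \<times> nat) set"
  assumes B: "diagram m n B"
begin

lemma finite_row: "finite {l. (i, l) \<in> B}"
  by (rule finite_subset[of _ "{1..n}"]) (use diagram_bounds[OF B] in auto)

lemma cell_le_row_length:
  assumes "(i, j) \<in> B"
  shows "j \<le> row_length B i"
proof -
  have "{1..j} \<subseteq> {l. (i, l) \<in> B}"
    using assms diagram_bounds[OF B assms] diagram_down[OF B assms, of i] by auto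
  from card_mono[OF finite_row this] show ?thesis by (simp add: row_length_def)
qed

lemma cell_column_gap_less:
  assumes "(i, j) \<in> B"
  shows "column_gap m B j < i"
proof -
  have "{k \<in> {1..m}. (k, j) \<notin> B} \<subseteq> {1..<i}"
  proof
    fix k assume "k \<in> {k \<in> {1..m}. (k, j) \<notin> B}"
    then show "k \<in> {1..<i}"
      using diagram_bounds[OF B assms] diagram_down[OF B assms, of k j] by (cases "i \<le> k") auto
  qed
  from card_mono[OF _ this] have "column_gap m B j \<le> i - 1" by (simp add: column_gap_def)
  then show ?thesis using diagram_bounds[OF B assms] by auto
qed

lemma non_cell_row_length_less:
  assumes "(i, j) \<notin> B" "i \<in> {1..m}" "j \<in> {1..n}"
  shows "row_length B i < j"
proof -
  have "{l. (i, l) \<in> B} \<subseteq> {1..<j}"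
  proof
    fix l assume l: "l \<in> {l. (i, l) \<in> B}"
    then show "l \<in> {1..<j}"
      using assms diagram_bounds[OF B, of i l] diagram_down[OF B, of i l i j] by (cases "j \<le> l") auto
  qed
  from card_mono[OF _ this] have "row_length B i \<le> j - 1" by (simp add: row_length_def)
  then show ?thesis using assms by auto
qed

lemma non_cell_le_column_gap:
  assumes "(i, j) \<notin> B" "i \<in> {1..m}" "j \<in> {1..n}"
  shows "i \<le> column_gap m B j"
proof -
  have "{1..i} \<subseteq> {k \<in> {1..m}. (k, j) \<notin> B}"
    using assms diagram_down[OF B, of _ j i j] by auto
  from card_mono[OF _ this] show ?thesis by (simp add: column_gap_def)
qed

lemma row_length_mono: "i \<le> k \<Longrightarrow> k \<le> m \<Longrightarrow> row_length B i \<le> row_length B k"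
  unfolding row_length_def
  using diagram_bounds[OF B] diagram_down[OF B, of i _ k]
  by (intro card_mono[OF finite_row]) auto

lemma column_gap_mono: "1 \<le> j \<Longrightarrow> j \<le> l \<Longrightarrow> column_gap m B j \<le> column_gap m B l"
  unfolding column_gap_def
  using diagram_down[OF B, of _ l _ j] by (intro card_mono) auto

text \<open>The positions of epsilon_i and delta_j are i + \<open>row_length\<close> and j +
  \<open>column_gap\<close>. A cell gives j \<le> \<open>row_length\<close> and
  \<open>column_gap\<close> < i, a non-cell gives \<open>row_length\<close> < j and i \<le>
  \<open>column_gap\<close>; in both cases the two inequalities add up.\<close>

lemma shuffle_pos_cell:
  assumes "p < m" "m \<le> q" "q < m + n"
  shows "(p + 1, q - m + 1) \<in> B \<Longrightarrow> shuffle_pos m B q < shuffle_pos m B p"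
    and "(p + 1, q - m + 1) \<notin> B \<Longrightarrow> shuffle_pos m B p < shuffle_pos m B q"
proof -
  obtain t where q: "q = m + t" using assms(2) le_Suc_ex by blast
  then show "(p + 1, q - m + 1) \<in> B \<Longrightarrow> shuffle_pos m B q < shuffle_pos m B p"
    using assms cell_le_row_length[of "p + 1" "t + 1"] cell_column_gap_less[of "p + 1" "t + 1"]
    by (simp add: shuffle_pos_def)
  show "(p + 1, q - m + 1) \<notin> B \<Longrightarrow> shuffle_pos m B p < shuffle_pos m B q"
    using assms non_cell_row_length_less[of "p + 1" "t + 1"] non_cell_le_column_gap[of "p + 1" "t + 1"]
    by (simp add: shuffle_pos_def q)
qed

lemma shuffle_pos_mono:
  assumes "p < q" "p < m \<longleftrightarrow> q < m"
  shows "shuffle_pos m B p < shuffle_pos m B q"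
proof (cases "p < m")
  case True
  then show ?thesis using assms row_length_mono[of "p + 1" "q + 1"] by (auto simp: shuffle_pos_def)
next
  case False
  then obtain s where "p = m + s" using le_Suc_ex not_less by blast
  moreover obtain t where "q = m + t" using False assms(1) le_Suc_ex[of m q] by auto
  ultimately show ?thesis
    using assms(1) column_gap_mono[of "s + 1" "t + 1"] by (simp add: shuffle_pos_def)
qed

lemma shuffle_pos_inj: "inj_on (shuffle_pos m B) {..<m + n}"
proof (rule linorder_inj_onI)
  fix p q assume "p < q" "p \<in> {..<m + n}" "q \<in> {..<m + n}"
  then show "shuffle_pos m B p \<noteq> shuffle_pos m B q"
    using shuffle_pos_mono[of p q] shuffle_pos_cell[of p q]
    by (cases "q < m"; cases "p < m"; cases "(p + 1, q - m + 1) \<in> B") auto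
qed auto

context
  fixes i j :: nat
  assumes corner: "(i, j) \<notin> B" "diagram m n (insert (i, j) B)"
begin

lemma corner_bounds: "i \<in> {1..m}" "j \<in> {1..n}"
  using diagram_bounds[OF corner(2)] by auto

lemma corner_row: "{l. (i, l) \<in> B} = {1..<j}"
proof (intro Set.set_eqI iffI)
  fix l assume "l \<in> {l. (i, l) \<in> B}"
  then show "l \<in> {1..<j}"
    using diagram_bounds[OF B, of i l] diagram_down[OF B, of i l i j] corner_bounds corner(1)
    by (cases "j \<le> l") auto
next
  fix l assume "l \<in> {1..<j}"
  then show "l \<in> {l. (i, l) \<in> B}"
    using diagram_down[OF corner(2), of i j i l] corner_bounds by auto
qed

lemma corner_column: "k \<in> {1..m} \<Longrightarrow> (k, j) \<in> B \<longleftrightarrow> i < k"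
  using diagram_down[OF corner(2), of i j k j] diagram_down[OF B, of k j i j] corner_bounds corner(1)
  by (cases "i < k") auto

text \<open>At an addable corner the row has exactly j - 1 cells and the column misses exactly the
  rows 1, ..., i. So epsilon_i and delta_j stand at the positions i + j - 1 and i + j, and the new
  cell exchanges them.\<close>

lemma shuffle_pos_corner:
  shows "shuffle_pos m B (m + j - 1) = Suc (shuffle_pos m B (i - 1))"
    and "shuffle_pos m (insert (i, j) B) = (shuffle_pos m B)
      (i - 1 := shuffle_pos m B (m + j - 1), m + j - 1 := shuffle_pos m B (i - 1))"
proof -
  let ?B' = "insert (i, j) B"
  have row: "row_length B i = j - 1" by (simp add: row_length_def corner_row)
  have "{k \<in> {1..m}. (k, j) \<notin> B} = {1..i}"
    using corner_column corner_bounds by auto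
  then have col: "column_gap m B j = i" by (simp add: column_gap_def)
  have "{l. (i, l) \<in> ?B'} = insert j {l. (i, l) \<in> B}" by auto
  also have "\<dots> = {1..j}" unfolding corner_row using corner_bounds by auto
  finally have "{l. (i, l) \<in> ?B'} = {1..j}" .
  then have row': "row_length ?B' i = j" by (simp add: row_length_def)
  have "{k \<in> {1..m}. (k, j) \<notin> ?B'} = {1..<i}"
    using corner_column corner_bounds by auto
  then have col': "column_gap m ?B' j = i - 1" by (simp add: column_gap_def)
  have other: "row_length ?B' k = row_length B k" if "k \<noteq> i" for k
    using that by (simp add: row_length_def)
  have other': "column_gap m ?B' l = column_gap m B l" if "l \<noteq> j" for l
    using that by (simp add: column_gap_def)
  show 1: "shuffle_pos m B (m + j - 1) = Suc (shuffle_pos m B (i - 1))"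
    using corner_bounds by (auto simp: shuffle_pos_def row col)
  show "shuffle_pos m ?B' = (shuffle_pos m B)
      (i - 1 := shuffle_pos m B (m + j - 1), m + j - 1 := shuffle_pos m B (i - 1))"
  proof
    fix r
    consider "r = i - 1" | "r = m + j - 1" | "r \<noteq> i - 1" "r \<noteq> m + j - 1" by blast
    then show "shuffle_pos m ?B' r = ((shuffle_pos m B)
      (i - 1 := shuffle_pos m B (m + j - 1), m + j - 1 := shuffle_pos m B (i - 1))) r"
    proof cases
      case 1
      then show ?thesis using corner_bounds by (auto simp: shuffle_pos_def row' col)
    next
      case 2
      then show ?thesis using corner_bounds by (auto simp: shuffle_pos_def row col')
    next
      case 3
      then have "r + 1 \<noteq> i" "m \<le> r \<Longrightarrow> r - m + 1 \<noteq> j" using corner_bounds by auto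
      with 3 show ?thesis using other[of "r + 1"] other'[of "r - m + 1"]
        by (auto simp: shuffle_pos_def)
    qed
  qed
qed

end

end

section \<open>Positive systems of standard bases and their diagrams\<close>

interpretation weight_space: vector_space wscale
  by unfold_locales (auto simp: wscale_def fun_eq_iff algebra_simps)

lemma base_subset_positive_roots:
  assumes "S \<subseteq> roots m n"
  shows "S \<subseteq> positive_roots m n S"
proof
  fix \<beta> assume \<beta>: "\<beta> \<in> S"
  have "finite S" using assms finite_roots finite_subset by blast
  have "(\<Sum>\<gamma>\<in>S. wscale (of_nat (if \<gamma> = \<beta> then 1 else 0)) \<gamma>) = (\<Sum>\<gamma>\<in>S. if \<gamma> = \<beta> then \<beta> else 0)"
    by (intro sum.cong) auto
  also have "\<dots> = \<beta>" using \<open>finite S\<close> \<beta> by simp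
  finally have "\<beta> = (\<Sum>\<gamma>\<in>S. wscale (of_nat (if \<gamma> = \<beta> then 1 else 0)) \<gamma>)" by simp
  then show "\<beta> \<in> positive_roots m n S"
    using \<beta> assms unfolding positive_roots_def
    by (intro CollectI conjI exI[of _ "\<lambda>\<gamma>. if \<gamma> = \<beta> then 1 else 0"]) auto
qed

lemma positive_roots_add:
  assumes "\<alpha> \<in> positive_roots m n S" "\<beta> \<in> positive_roots m n S" "\<alpha> + \<beta> \<in> roots m n"
  shows "\<alpha> + \<beta> \<in> positive_roots m n S"
proof -
  obtain c d :: "weight \<Rightarrow> nat" where
    "\<alpha> = (\<Sum>\<gamma>\<in>S. wscale (of_nat (c \<gamma>)) \<gamma>)" "\<beta> = (\<Sum>\<gamma>\<in>S. wscale (of_nat (d \<gamma>)) \<gamma>)"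
    using assms unfolding positive_roots_def by blast
  then have "\<alpha> + \<beta> = (\<Sum>\<gamma>\<in>S. wscale (of_nat (c \<gamma> + d \<gamma>)) \<gamma>)"
    by (simp add: sum.distrib[symmetric] weight_space.scale_left_distrib)
  then show ?thesis using assms(3) unfolding positive_roots_def
    by (intro CollectI conjI exI[of _ "\<lambda>\<gamma>. c \<gamma> + d \<gamma>"]) auto
qed

text \<open>Adding the two expansions gives a relation with natural coefficients; independence makes
  all of them vanish, contradicting that a root is nonzero.\<close>

lemma positive_roots_not_both:
  assumes S: "S \<subseteq> roots m n" "\<not> weight_space.dependent S"
    and "\<alpha> \<in> positive_roots m n S" "- \<alpha> \<in> positive_roots m n S"
  shows False
proof -
  have fin: "finite S" using S finite_roots finite_subset by blast
  obtain c d :: "weight \<Rightarrow> nat" where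
    c: "\<alpha> = (\<Sum>\<gamma>\<in>S. wscale (of_nat (c \<gamma>)) \<gamma>)" and d: "- \<alpha> = (\<Sum>\<gamma>\<in>S. wscale (of_nat (d \<gamma>)) \<gamma>)"
    using assms unfolding positive_roots_def by blast
  have "(\<Sum>\<gamma>\<in>S. wscale (of_nat (c \<gamma> + d \<gamma>)) \<gamma>) =
      (\<Sum>\<gamma>\<in>S. wscale (of_nat (c \<gamma>)) \<gamma>) + (\<Sum>\<gamma>\<in>S. wscale (of_nat (d \<gamma>)) \<gamma>)"
    by (simp add: sum.distrib[symmetric] weight_space.scale_left_distrib)
  also have "\<dots> = 0" unfolding c[symmetric] d[symmetric] by simp
  finally have zero: "(\<Sum>\<gamma>\<in>S. wscale (of_nat (c \<gamma> + d \<gamma>)) \<gamma>) = 0" .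
  have "c \<gamma> = 0" if "\<gamma> \<in> S" for \<gamma>
  proof -
    have "(of_nat (c \<gamma> + d \<gamma>) :: complex) = 0"
      by (rule weight_space.independentD[OF S(2) fin order_refl zero that])
    then show ?thesis by (simp only: of_nat_eq_0_iff)
  qed
  then have "\<alpha> = 0" unfolding c by simp
  moreover obtain p q where "\<alpha> = row_weight m p - row_weight m q" "p \<noteq> q"
    using assms(3) by (auto simp: positive_roots_def roots_rows)
  ultimately show False using row_weight_diff_nonzero by metis
qed

text \<open>The difference of positions extends to a linear functional, positive on all ordered roots.\<close>

definition depth :: "nat \<Rightarrow> nat \<Rightarrow> (nat \<Rightarrow> nat) \<Rightarrow> weight \<Rightarrow> complex" where
  "depth m n pos \<nu> = - (\<Sum>r<m + n. of_nat (pos r) * \<nu> (index_of m r))"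

lemma depth_sum: "depth m n pos (\<Sum>\<beta>\<in>S. wscale (c \<beta>) \<beta>) = (\<Sum>\<beta>\<in>S. c \<beta> * depth m n pos \<beta>)"
proof -
  have "depth m n pos (\<alpha> + \<beta>) = depth m n pos \<alpha> + depth m n pos \<beta>" for \<alpha> \<beta>
    by (simp add: depth_def distrib_left sum.distrib)
  moreover have "depth m n pos (wscale c \<beta>) = c * depth m n pos \<beta>" for c \<beta>
    by (simp add: depth_def wscale_def sum_distrib_left mult.left_commute)
  moreover have "depth m n pos 0 = 0" by (simp add: depth_def)
  ultimately show ?thesis by (induction S rule: infinite_finite_induct) auto
qed

lemma depth_row_weight_diff:
  assumes "p < m + n" "q < m + n"
  shows "depth m n pos (row_weight m p - row_weight m q) = of_nat (pos q) - of_nat (pos p)"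
proof -
  have "of_nat (pos r) * (row_weight m p - row_weight m q) (index_of m r) =
      (if r = p then of_nat (pos p) else 0) - (if r = q then of_nat (pos q) else 0)" for r
    by (simp add: row_weight_apply)
  then show ?thesis using assms by (simp add: depth_def sum_subtractf)
qed

lemma ordered_root_depth:
  assumes "\<beta> \<in> ordered_roots m n pos"
  shows "\<exists>k\<ge>1. depth m n pos \<beta> = of_nat k"
proof -
  obtain p q where "\<beta> = row_weight m p - row_weight m q" "p < m + n" "q < m + n" "pos p < pos q"
    using assms by (auto simp: ordered_roots_def)
  then show ?thesis
    by (intro exI[of _ "pos q - pos p"]) (auto simp: depth_row_weight_diff of_nat_diff)
qed

lemma ordered_expansion_depth:
  assumes S: "S \<subseteq> ordered_roots m n pos"
    and \<alpha>: "\<alpha> = (\<Sum>\<beta>\<in>S. wscale (of_nat (c \<beta>)) \<beta>)"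
  obtains g where "\<And>\<beta>. \<beta> \<in> S \<Longrightarrow> g \<beta> \<ge> 1" "depth m n pos \<alpha> = of_nat (\<Sum>\<beta>\<in>S. c \<beta> * g \<beta>)"
proof -
  have "\<forall>\<beta>\<in>S. \<exists>k\<ge>1. depth m n pos \<beta> = of_nat k" using ordered_root_depth S by blast
  then obtain g where g: "\<forall>\<beta>\<in>S. g \<beta> \<ge> 1 \<and> depth m n pos \<beta> = of_nat (g \<beta>)" by metis
  have "depth m n pos \<alpha> = (\<Sum>\<beta>\<in>S. of_nat (c \<beta>) * of_nat (g \<beta>))"
    unfolding \<alpha> depth_sum using g by (intro sum.cong) auto
  then show ?thesis using that[of g] g by simp
qed

lemma positive_roots_subset_ordered:
  assumes pos: "inj_on pos {..<m + n}" and S: "S \<subseteq> ordered_roots m n pos"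
  shows "positive_roots m n S \<subseteq> ordered_roots m n pos"
proof
  fix \<alpha> assume \<alpha>: "\<alpha> \<in> positive_roots m n S"
  then obtain p q where pq: "\<alpha> = row_weight m p - row_weight m q" "p < m + n" "q < m + n" "p \<noteq> q"
    by (auto simp: positive_roots_def roots_rows)
  from \<alpha> obtain c :: "weight \<Rightarrow> nat" where "\<alpha> = (\<Sum>\<beta>\<in>S. wscale (of_nat (c \<beta>)) \<beta>)"
    by (auto simp: positive_roots_def)
  from ordered_expansion_depth[OF S this] obtain k :: nat where "depth m n pos \<alpha> = of_nat k" by metis
  then have "of_nat (pos q) = (of_nat (pos p + k) :: complex)"
    by (simp add: pq depth_row_weight_diff algebra_simps)
  then have "pos q = pos p + k" by (simp only: of_nat_eq_iff)
  moreover have "pos p \<noteq> pos q" using inj_onD[OF pos, of p q] pq by auto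
  ultimately have "pos p < pos q" by simp
  then show "\<alpha> \<in> ordered_roots m n pos" using pq by (auto simp: ordered_roots_def)
qed

text \<open>Depth 1 cannot be split: every element of \<open>S\<close> has depth at least 1, so the
  expansion of an adjacent root is a single base element with coefficient 1.\<close>

lemma adjacent_root_simple:
  assumes S: "S \<subseteq> ordered_roots m n pos" "finite S"
    and pq: "p < m + n" "q < m + n" "pos q = Suc (pos p)"
    and \<alpha>: "row_weight m p - row_weight m q \<in> positive_roots m n S"
  shows "row_weight m p - row_weight m q \<in> S"
proof -
  let ?\<alpha> = "row_weight m p - row_weight m q"
  from \<alpha> obtain c :: "weight \<Rightarrow> nat" where c: "?\<alpha> = (\<Sum>\<beta>\<in>S. wscale (of_nat (c \<beta>)) \<beta>)"
    by (auto simp: positive_roots_def)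
  obtain g where g: "\<And>\<beta>. \<beta> \<in> S \<Longrightarrow> g \<beta> \<ge> (1::nat)"
    "depth m n pos ?\<alpha> = of_nat (\<Sum>\<beta>\<in>S. c \<beta> * g \<beta>)"
    by (rule ordered_expansion_depth[OF S(1) c]) blast
  then have "of_nat (\<Sum>\<beta>\<in>S. c \<beta> * g \<beta>) = (of_nat 1 :: complex)"
    using pq by (simp add: depth_row_weight_diff del: of_nat_sum)
  then have "(\<Sum>\<beta>\<in>S. c \<beta> * g \<beta>) = 1" by (simp only: of_nat_eq_iff)
  then obtain \<beta> where \<beta>: "\<beta> \<in> S" "c \<beta> * g \<beta> = 1" and z: "\<And>\<gamma>. \<gamma> \<in> S \<Longrightarrow> \<beta> \<noteq> \<gamma> \<Longrightarrow> c \<gamma> * g \<gamma> = 0"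
    unfolding sum_eq_1_iff[OF S(2)] by blast
  have "c \<gamma> = (if \<gamma> = \<beta> then 1 else 0)" if "\<gamma> \<in> S" for \<gamma>
    using \<beta> z[OF that] g(1)[OF that] by auto
  then have "?\<alpha> = (\<Sum>\<gamma>\<in>S. if \<gamma> = \<beta> then \<beta> else 0)"
    unfolding c by (intro sum.cong) auto
  then show ?thesis using \<beta> S(2) by simp
qed

lemma standard_even_root_positive:
  assumes "S \<in> standard_bases m n" "p < q" "q < m + n" "p < m \<longleftrightarrow> q < m"
  shows "row_weight m p - row_weight m q \<in> positive_roots m n S"
proof -
  have "row_weight m p - row_weight m q \<in>
      {eps i - eps j | i j. 1 \<le> i \<and> i < j \<and> j \<le> m} \<union>
      {del i - del j | i j. 1 \<le> i \<and> i < j \<and> j \<le> n}"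
  proof (cases "q < m")
    case True
    then show ?thesis using assms
      by (intro UnI1 CollectI exI[of _ "p + 1"] exI[of _ "q + 1"]) (auto simp: row_weight_eps)
  next
    case False
    then show ?thesis using assms
      by (intro UnI2 CollectI exI[of _ "p - m + 1"] exI[of _ "q - m + 1"]) (auto simp: row_weight_del)
  qed
  then show ?thesis using assms(1) unfolding standard_bases_def by blast
qed

definition base_diagram :: "nat \<Rightarrow> nat \<Rightarrow> weight set \<Rightarrow> (nat \<times> nat) set" where
  "base_diagram m n S = {(i, j). i \<in> {1..m} \<and> j \<in> {1..n} \<and> del j - eps i \<in> positive_roots m n S}"

text \<open>Adding the positive even roots epsilon_i - epsilon_i' and delta_j' - delta_j to delta_j
  - epsilon_i moves a cell in the two directions in which a diagram is closed.\<close>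

lemma diagram_base_diagram:
  assumes S: "S \<in> standard_bases m n"
  shows "diagram m n (base_diagram m n S)"
  unfolding diagram_def
proof (intro conjI allI impI)
  fix i j i' j' assume *: "(i, j) \<in> base_diagram m n S" "i \<le> i'" "i' \<le> m" "1 \<le> j'" "j' \<le> j"
  then have ij: "i \<in> {1..m}" "j \<in> {1..n}" and pos: "del j - eps i \<in> positive_roots m n S"
    by (auto simp: base_diagram_def)
  have root: "del b - eps a \<in> roots m n" if "a \<in> {1..m}" "b \<in> {1..n}" for a b
    using that unfolding roots_rows
    by (intro CollectI exI[of _ "m + b - 1"] exI[of _ "a - 1"])
      (auto simp: eps_row_weight del_row_weight[of _ m])
  have "del j - eps i' \<in> positive_roots m n S"
  proof (cases "i = i'")
    case False
    then have "i - 1 < i' - 1" "i' - 1 < m + n" "i - 1 < m \<longleftrightarrow> i' - 1 < m" using * ij by auto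
    then have "eps i - eps i' \<in> positive_roots m n S"
      using standard_even_root_positive[OF S, of "i - 1" "i' - 1"] * ij by (simp add: eps_row_weight[of _ m])
    then have "(del j - eps i) + (eps i - eps i') \<in> positive_roots m n S"
      using pos root[of i' j] * ij by (intro positive_roots_add) auto
    then show ?thesis by simp
  qed (use pos in simp)
  then have "del j' - eps i' \<in> positive_roots m n S" if "j \<noteq> j'"
  proof -
    have "m + j' - 1 < m + j - 1" "m + j - 1 < m + n" "m + j' - 1 < m \<longleftrightarrow> m + j - 1 < m"
      using * ij that by auto
    then have "del j' - del j \<in> positive_roots m n S"
      using standard_even_root_positive[OF S, of "m + j' - 1" "m + j - 1"] * ij that
      by (simp add: del_row_weight[of _ m])
    then have "(del j' - del j) + (del j - eps i') \<in> positive_roots m n S"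
      using \<open>del j - eps i' \<in> positive_roots m n S\<close> root[of i' j'] * ij
      by (intro positive_roots_add) auto
    then show ?thesis by simp
  qed
  with \<open>del j - eps i' \<in> positive_roots m n S\<close> * ij show "(i', j') \<in> base_diagram m n S"
    by (cases "j = j'") (auto simp: base_diagram_def)
qed (auto simp: base_diagram_def)

text \<open>For a base, exactly one of a root and its negative is positive, so it suffices to decide
  the orientation of each pair of rows. Standardness decides the even pairs and the diagram the odd
  ones.\<close>

lemma positive_roots_base_diagram:
  assumes S: "S \<in> standard_bases m n"
  shows "positive_roots m n S = ordered_roots m n (shuffle_pos m (base_diagram m n S))"
proof -
  let ?P = "positive_roots m n S" and ?B = "base_diagram m n S"
  note B = diagram_base_diagram[OF S]
  have base: "is_base m n S" using S by (simp add: standard_bases_def)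
  have excl: "- \<alpha> \<notin> ?P" if "\<alpha> \<in> ?P" for \<alpha>
    using positive_roots_not_both[of S m n \<alpha>] base that by (auto simp: is_base_def)
  have total: "\<alpha> \<in> ?P \<or> - \<alpha> \<in> ?P" if "\<alpha> \<in> roots m n" for \<alpha>
    using base that by (auto simp: is_base_def)
  have iff: "row_weight m p - row_weight m q \<in> ?P \<longleftrightarrow> row_weight m q - row_weight m p \<notin> ?P"
    if "p < m + n" "q < m + n" "p \<noteq> q" for p q
    using excl[of "row_weight m p - row_weight m q"] total[of "row_weight m p - row_weight m q"] that
    by (auto simp: roots_rows)
  have cell: "row_weight m q - row_weight m p \<in> ?P \<longleftrightarrow> (p + 1, q - m + 1) \<in> ?B"
    if "p < m" "m \<le> q" "q < m + n" for p q
  proof -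
    have "q - m + 1 \<le> n" using that by auto
    then show ?thesis using that by (simp add: base_diagram_def row_weight_eps row_weight_del)
  qed
  have lt: "row_weight m p - row_weight m q \<in> ?P \<longleftrightarrow> shuffle_pos m ?B p < shuffle_pos m ?B q"
    if "p < q" "q < m + n" for p q
  proof (cases "p < m \<longleftrightarrow> q < m")
    case True
    then show ?thesis using shuffle_pos_mono[OF B that(1)] standard_even_root_positive[OF S that] by simp
  next
    case False
    then have "p < m" "m \<le> q" using that by auto
    then show ?thesis
      using iff[of p q] cell[of p q] shuffle_pos_cell[OF B, of p q] that
      by (cases "(p + 1, q - m + 1) \<in> ?B") auto
  qed
  have all: "row_weight m p - row_weight m q \<in> ?P \<longleftrightarrow> shuffle_pos m ?B p < shuffle_pos m ?B q"
    if "p \<noteq> q" "p < m + n" "q < m + n" for p q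
  proof (cases "p < q")
    case False
    then have "shuffle_pos m ?B p \<noteq> shuffle_pos m ?B q"
      using inj_onD[OF shuffle_pos_inj[OF B], of p q] that by auto
    then show ?thesis using iff[of p q] lt[of q p] that False by auto
  qed (use lt that in simp)
  show ?thesis
  proof (intro Set.set_eqI iffI)
    fix \<alpha> assume "\<alpha> \<in> ?P"
    moreover from this obtain p q where "\<alpha> = row_weight m p - row_weight m q"
      "p < m + n" "q < m + n" "p \<noteq> q" by (auto simp: positive_roots_def roots_rows)
    ultimately show "\<alpha> \<in> ordered_roots m n (shuffle_pos m ?B)"
      using all by (auto simp: ordered_roots_def)
  next
    fix \<alpha> assume "\<alpha> \<in> ordered_roots m n (shuffle_pos m ?B)"
    then obtain p q where "\<alpha> = row_weight m p - row_weight m q"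
      "p < m + n" "q < m + n" "shuffle_pos m ?B p < shuffle_pos m ?B q"
      by (auto simp: ordered_roots_def)
    then show "\<alpha> \<in> ?P" using all[of p q] by (cases "p = q") auto
  qed
qed

definition cell_root :: "nat \<times> nat \<Rightarrow> weight" where
  "cell_root = (\<lambda>(i, j). eps i - del j)"

lemma cell_root_rows:
  "i \<in> {1..m} \<Longrightarrow> 1 \<le> j \<Longrightarrow> cell_root (i, j) = row_weight m (i - 1) - row_weight m (m + j - 1)"
  using eps_row_weight[of i m] del_row_weight[of j m] by (simp add: cell_root_def)

lemma inj_on_cell_root: "inj_on cell_root ({1..m} \<times> {1..n})"
proof (rule inj_onI)
  fix x y assume "x \<in> {1..m} \<times> {1..n}" "y \<in> {1..m} \<times> {1..n}" "cell_root x = cell_root y"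
  then show "x = y"
    by (cases x; cases y) (auto simp: cell_root_rows[of _ m] row_weight_diff_eq_iff)
qed

lemma right_odd_roots_cells: "right_odd_roots m n = cell_root ` ({1..m} \<times> {1..n})"
  by (force simp: right_odd_roots_def cell_root_def)

lemma cell_root_positive_iff:
  assumes S: "S \<in> standard_bases m n" and ij: "i \<in> {1..m}" "j \<in> {1..n}"
  shows "cell_root (i, j) \<in> positive_roots m n S \<longleftrightarrow> (i, j) \<notin> base_diagram m n S"
proof -
  note B = diagram_base_diagram[OF S]
  have "cell_root (i, j) \<in> positive_roots m n S \<longleftrightarrow>
      shuffle_pos m (base_diagram m n S) (i - 1) < shuffle_pos m (base_diagram m n S) (m + j - 1)"
    using ij unfolding positive_roots_base_diagram[OF S]
    by (subst ordered_roots_iff[symmetric, of _ m n]) (auto simp: cell_root_rows)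
  moreover have "i - 1 < m" "m \<le> m + j - 1" "m + j - 1 < m + n" using ij by auto
  ultimately show ?thesis
    using shuffle_pos_cell[OF B, of "i - 1" "m + j - 1"] ij
    by (cases "(i, j) \<in> base_diagram m n S") auto
qed

text \<open>\<open>B_set\<close> is cut out by simple right odd roots, the diagram by positive
  roots. The link is that a minimal non-cell is an addable corner, hence an adjacent pair in the
  shuffle, hence a simple root.\<close>

lemma B_set_base_diagram:
  assumes S: "S \<in> standard_bases m n"
  shows "B_set m n S = cell_root ` base_diagram m n S"
proof -
  let ?B = "base_diagram m n S"
  note B = diagram_base_diagram[OF S]
  have roots: "S \<subseteq> roots m n" using S by (auto simp: standard_bases_def is_base_def)
  then have fin: "finite S" using finite_roots finite_subset by blast
  have ord: "S \<subseteq> ordered_roots m n (shuffle_pos m ?B)"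
    using base_subset_positive_roots[OF roots] positive_roots_base_diagram[OF S] by simp
  have "(\<exists>\<beta>\<in>S \<inter> right_odd_roots m n. root_le m n \<beta> (cell_root (i, j))) \<longleftrightarrow> (i, j) \<notin> ?B"
    if ij: "i \<in> {1..m}" "j \<in> {1..n}" for i j
  proof
    assume "\<exists>\<beta>\<in>S \<inter> right_odd_roots m n. root_le m n \<beta> (cell_root (i, j))"
    then obtain \<beta> k l i' j' where \<beta>: "\<beta> \<in> S" "\<beta> = cell_root (k, l)" "k \<in> {1..m}" "l \<in> {1..n}"
      "i' \<in> {1..m}" "j' \<in> {1..n}" "cell_root (i, j) = cell_root (i', j')" "i' \<le> k" "l \<le> j'"
      unfolding root_le_def cell_root_def by auto
    then have "i' = i" "j' = j" using inj_onD[OF inj_on_cell_root \<beta>(7), of m n] ij by auto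
    have "(k, l) \<notin> ?B"
      using \<beta> cell_root_positive_iff[OF S, of k l] base_subset_positive_roots[OF roots] by blast
    then show "(i, j) \<notin> ?B"
      using diagram_down[OF B, of i j k l] \<beta> \<open>i' = i\<close> \<open>j' = j\<close> by auto
  next
    assume nB: "(i, j) \<notin> ?B"
    define X where "X = {x \<in> {i..m} \<times> {1..j}. x \<notin> ?B}"
    have "finite X" "X \<noteq> {}" using nB ij by (auto simp: X_def)
    \<comment> \<open>The quantity (m - k) + l measures the distance from the cell (m, 1), where
      diagrams start; a non-cell of the window closest to it is addable.\<close>
    then obtain x where x: "x \<in> X" "\<And>y. y \<in> X \<Longrightarrow> \<not> (m - fst y) + snd y < (m - fst x) + snd x"
      using ex_min_if_finite[of "(\<lambda>x. (m - fst x) + snd x) ` X"] by blast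
    obtain k l where kl: "x = (k, l)" by (cases x)
    have k: "k \<in> {1..m}" "i \<le> k" and l: "l \<in> {1..n}" "l \<le> j" and klB: "(k, l) \<notin> ?B"
      using x(1) ij by (auto simp: X_def kl)
    have "diagram m n (insert (k, l) ?B)"
      unfolding diagram_def
    proof (intro conjI allI impI)
      show "insert (k, l) ?B \<subseteq> {1..m} \<times> {1..n}" using k l B by (auto simp: diagram_def)
      fix a b a' b' assume *: "(a, b) \<in> insert (k, l) ?B" "a \<le> a'" "a' \<le> m" "1 \<le> b'" "b' \<le> b"
      show "(a', b') \<in> insert (k, l) ?B"
      proof (cases "(a, b) \<in> ?B")
        case True
        then show ?thesis using diagram_down[OF B True] * by auto
      next
        case False
        then have ab: "a = k" "b = l" using * by auto
        show ?thesis
        proof (rule ccontr)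
          assume n: "(a', b') \<notin> insert (k, l) ?B"
          then have "(a', b') \<in> X" using ab * k l by (auto simp: X_def)
          from x(2)[OF this] have "a' = k \<and> b' = l" using ab * k l by (auto simp: kl)
          with n show False by simp
        qed
      qed
    qed
    then have "shuffle_pos m ?B (m + l - 1) = Suc (shuffle_pos m ?B (k - 1))"
      by (rule shuffle_pos_corner(1)[OF B klB])
    moreover have "cell_root (k, l) \<in> positive_roots m n S"
      using cell_root_positive_iff[OF S, of k l] k l klB by simp
    ultimately have "cell_root (k, l) \<in> S"
      using adjacent_root_simple[OF ord fin, of "k - 1" "m + l - 1"] k l
      by (auto simp: cell_root_rows[of _ m])
    moreover have "root_le m n (cell_root (k, l)) (cell_root (i, j))"
      unfolding root_le_def
      by (rule bexI[of _ k], rule bexI[of _ l], rule bexI[of _ i], rule bexI[of _ j])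
        (use k l ij in \<open>auto simp: cell_root_def\<close>)
    moreover have "cell_root (k, l) \<in> right_odd_roots m n"
      using k l by (auto simp: right_odd_roots_cells)
    ultimately show "\<exists>\<beta>\<in>S \<inter> right_odd_roots m n. root_le m n \<beta> (cell_root (i, j))" by blast
  qed
  then have "(\<exists>\<beta>\<in>S \<inter> right_odd_roots m n. root_le m n \<beta> (cell_root x)) \<longleftrightarrow> x \<notin> ?B"
    if "x \<in> {1..m} \<times> {1..n}" for x using that by (cases x) simp
  moreover have "?B \<subseteq> {1..m} \<times> {1..n}" using B by (simp add: diagram_def)
  moreover have "B_set m n S = {\<alpha> \<in> cell_root ` ({1..m} \<times> {1..n}).
      \<not> (\<exists>\<beta>\<in>S \<inter> right_odd_roots m n. root_le m n \<beta> \<alpha>)}"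
    unfolding B_set_def right_odd_roots_cells by blast
  ultimately show ?thesis by (simp only:) blast
qed

subsection \<open>The distinguished base\<close>

lemma shuffle_pos_empty: "shuffle_pos m {} = Suc"
proof -
  have "{k \<in> {1..m}. (k, j) \<notin> {}} = {1..m}" for j :: nat by auto
  then have "column_gap m {} j = m" for j by (simp only: column_gap_def card_atLeastAtMost diff_Suc_1 One_nat_def)
  then show ?thesis by (auto simp: shuffle_pos_def row_length_def fun_eq_iff)
qed

lemma diagram_empty: "diagram m n {}"
  by (simp add: diagram_def)

lemma dist_base_rows:
  "dist_base m n = {row_weight m p - row_weight m (p + 1) | p. p + 1 < m + n}"
proof (intro Set.set_eqI iffI)
  fix x assume "x \<in> dist_base m n"
  then consider i where "x = eps i - eps (i + 1)" "1 \<le> i" "i < m"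
    | "x = eps m - del 1" "1 \<le> m" "1 \<le> n"
    | j where "x = del j - del (j + 1)" "1 \<le> j" "j < n"
    unfolding dist_base_def by (auto split: if_splits)
  then show "x \<in> {row_weight m p - row_weight m (p + 1) | p. p + 1 < m + n}"
  proof cases
    case 1
    then show ?thesis by (intro CollectI exI[of _ "i - 1"]) (auto simp: row_weight_eps)
  next
    case 2
    then show ?thesis by (intro CollectI exI[of _ "m - 1"]) (auto simp: row_weight_eps row_weight_del)
  next
    case 3
    then show ?thesis
      by (intro CollectI exI[of _ "m + j - 1"]) (auto simp: row_weight_del)
  qed
next
  fix x assume "x \<in> {row_weight m p - row_weight m (p + 1) | p. p + 1 < m + n}"
  then obtain p where p: "x = row_weight m p - row_weight m (p + 1)" "p + 1 < m + n" by blast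
  consider "p + 1 < m" | "p + 1 = m" | "m \<le> p" by linarith
  then show "x \<in> dist_base m n"
  proof cases
    case 1
    then show ?thesis using p unfolding dist_base_def
      by (intro UnI1 CollectI exI[of _ "p + 1"]) (auto simp: row_weight_eps)
  next
    case 2
    then have "x = eps m - del 1" using p by (auto simp: row_weight_eps row_weight_del)
    then show ?thesis using 2 p unfolding dist_base_def by (intro UnI1 UnI2) auto
  next
    case 3
    then have "x = del (p - m + 1) - del (p - m + 1 + 1)" using p by (simp add: row_weight_del Suc_diff_le)
    then show ?thesis using 3 p unfolding dist_base_def
      by (intro UnI2 CollectI exI[of _ "p - m + 1"]) auto
  qed
qed

text \<open>\<open>Suc\<close> is the position function of the empty diagram, so the distinguished
  base is the start of every chain. Roots between distant rows telescope into consecutive ones; the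
  other inclusion comes from \<open>depth\<close>.\<close>

lemma positive_roots_dist_base: "positive_roots m n (dist_base m n) = ordered_roots m n Suc"
proof
  have sub: "dist_base m n \<subseteq> ordered_roots m n Suc"
    unfolding dist_base_rows ordered_roots_def by force
  then show "positive_roots m n (dist_base m n) \<subseteq> ordered_roots m n Suc"
    by (intro positive_roots_subset_ordered) auto
  have "dist_base m n \<subseteq> roots m n"
    unfolding dist_base_rows roots_rows by force
  from base_subset_positive_roots[OF this]
  have simple: "row_weight m p - row_weight m (Suc p) \<in> positive_roots m n (dist_base m n)"
    if "Suc p < m + n" for p
    by (rule subsetD) (use that in \<open>auto simp: dist_base_rows\<close>)
  have *: "p + Suc k < m + n \<longrightarrow>
      row_weight m p - row_weight m (p + Suc k) \<in> positive_roots m n (dist_base m n)" for p k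
  proof (induction k)
    case 0
    show ?case using simple[of p] unfolding add_Suc_right add_0_right by (rule impI)
  next
    case (Suc k)
    show ?case
    proof
      assume k: "p + Suc (Suc k) < m + n"
      then have "(row_weight m p - row_weight m (p + Suc k)) +
          (row_weight m (p + Suc k) - row_weight m (p + Suc (Suc k))) \<in> roots m n"
        unfolding roots_rows by (intro CollectI exI[of _ p] exI[of _ "p + Suc (Suc k)"]) auto
      moreover have "row_weight m p - row_weight m (p + Suc k) \<in> positive_roots m n (dist_base m n)"
        by (rule mp[OF Suc.IH]) (use k in linarith)
      moreover have "row_weight m (p + Suc k) - row_weight m (p + Suc (Suc k)) \<in>
          positive_roots m n (dist_base m n)"
        using simple[of "p + Suc k"] k by simp
      ultimately have "(row_weight m p - row_weight m (p + Suc k)) +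
          (row_weight m (p + Suc k) - row_weight m (p + Suc (Suc k))) \<in>
          positive_roots m n (dist_base m n)"
        by (intro positive_roots_add)
      then show "row_weight m p - row_weight m (p + Suc (Suc k)) \<in>
          positive_roots m n (dist_base m n)" by simp
    qed
  qed
  have "row_weight m p - row_weight m q \<in> positive_roots m n (dist_base m n)"
    if "p < q" "q < m + n" for p q
    using *[of p "q - p - 1"] that by auto
  then show "ordered_roots m n Suc \<subseteq> positive_roots m n (dist_base m n)"
    by (auto simp: ordered_roots_def)
qed

subsection \<open>The Weyl vectors\<close>

lemma weight_sum_apply: "(\<Sum>x\<in>A. f x) k = (\<Sum>x\<in>A. f x k)" for f :: "'a \<Rightarrow> weight"
  by (induction A rule: infinite_finite_induct) auto

definition even_row_pairs :: "nat \<Rightarrow> nat \<Rightarrow> (nat \<times> nat) set" where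
  "even_row_pairs m n = {(p, q). p < q \<and> q < m + n \<and> (p < m \<longleftrightarrow> q < m)}"

lemma finite_even_row_pairs: "finite (even_row_pairs m n)"
  by (rule finite_subset[of _ "{..<m + n} \<times> {..<m + n}"]) (auto simp: even_row_pairs_def)

lemma ordered_even_roots:
  assumes B: "diagram m n B"
  shows "ordered_roots m n (shuffle_pos m B) \<inter> even_roots m n =
    (\<lambda>(p, q). row_weight m p - row_weight m q) ` even_row_pairs m n" (is "?L = ?R")
proof (intro Set.set_eqI iffI)
  fix x assume "x \<in> ?L"
  then obtain p q where pq: "x = row_weight m p - row_weight m q" "p < m + n" "q < m + n" "p \<noteq> q"
    "p < m \<longleftrightarrow> q < m" and "x \<in> ordered_roots m n (shuffle_pos m B)" unfolding even_roots_rows by blast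
  then have "shuffle_pos m B p < shuffle_pos m B q" by (simp add: ordered_roots_iff)
  then have "p < q" using shuffle_pos_mono[OF B, of q p] pq by (cases p q rule: linorder_cases) auto
  with pq show "x \<in> ?R" by (auto simp: even_row_pairs_def)
next
  fix x assume "x \<in> ?R"
  then obtain p q where pq: "x = row_weight m p - row_weight m q" "p < q" "q < m + n" "p < m \<longleftrightarrow> q < m"
    by (auto simp: even_row_pairs_def)
  then have "x \<in> even_roots m n" unfolding even_roots_rows
    by (intro CollectI exI[of _ p] exI[of _ q]) auto
  moreover have "x \<in> ordered_roots m n (shuffle_pos m B)"
    using pq shuffle_pos_mono[OF B, of p q] by (simp add: ordered_roots_iff)
  ultimately show "x \<in> ?L" by simp
qed

lemma ordered_odd_roots:
  assumes B: "diagram m n B"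
  shows "ordered_roots m n (shuffle_pos m B) \<inter> odd_roots m n =
    cell_root ` ({1..m} \<times> {1..n} - B) \<union> uminus ` cell_root ` B" (is "?L = ?R")
proof -
  have cell: "cell_root (i, j) \<in> ordered_roots m n (shuffle_pos m B) \<longleftrightarrow> (i, j) \<notin> B"
    "- cell_root (i, j) \<in> ordered_roots m n (shuffle_pos m B) \<longleftrightarrow> (i, j) \<in> B"
    if "i \<in> {1..m}" "j \<in> {1..n}" for i j
  proof -
    have ij: "i - 1 < m" "m \<le> m + j - 1" "m + j - 1 < m + n" "i - 1 + 1 = i" "m + j - 1 - m + 1 = j"
      using that by auto
    have "cell_root (i, j) = row_weight m (i - 1) - row_weight m (m + j - 1)"
      using that by (intro cell_root_rows) auto
    then have *: "cell_root (i, j) \<in> ordered_roots m n (shuffle_pos m B) \<longleftrightarrow>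
          shuffle_pos m B (i - 1) < shuffle_pos m B (m + j - 1)"
        "- cell_root (i, j) \<in> ordered_roots m n (shuffle_pos m B) \<longleftrightarrow>
          shuffle_pos m B (m + j - 1) < shuffle_pos m B (i - 1)"
      using ij ordered_roots_iff[of "i - 1" m n "m + j - 1"] ordered_roots_iff[of "m + j - 1" m n "i - 1"]
      by auto
    show "cell_root (i, j) \<in> ordered_roots m n (shuffle_pos m B) \<longleftrightarrow> (i, j) \<notin> B"
      "- cell_root (i, j) \<in> ordered_roots m n (shuffle_pos m B) \<longleftrightarrow> (i, j) \<in> B"
      unfolding * using shuffle_pos_cell[OF B ij(1-3)] unfolding ij(4,5)
      by (cases "(i, j) \<in> B"; simp)+
  qed
  have BG: "B \<subseteq> {1..m} \<times> {1..n}" using B by (simp add: diagram_def)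
  have "odd_roots m n = cell_root ` ({1..m} \<times> {1..n}) \<union> uminus ` cell_root ` ({1..m} \<times> {1..n})"
    by (simp add: odd_roots_def right_odd_roots_cells)
  then show ?thesis using cell BG by (auto simp del: minus_diff_eq)
qed

lemma sum_cell_root:
  assumes "A \<subseteq> {1..m} \<times> {1..n}"
  shows "(\<Sum>\<alpha>\<in>cell_root ` A. f \<alpha>) = (\<Sum>x\<in>A. f (cell_root x))"
  using sum.reindex[OF inj_on_subset[OF inj_on_cell_root assms], of f] by (simp add: o_def)

lemma sum_ordered_odd_roots:
  assumes B: "diagram m n B"
  shows "(\<Sum>\<alpha>\<in>ordered_roots m n (shuffle_pos m B) \<inter> odd_roots m n. \<alpha>) =
    (\<Sum>x\<in>{1..m} \<times> {1..n}. cell_root x) - wscale 2 (\<Sum>x\<in>B. cell_root x)"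
proof -
  let ?G = "{1..m} \<times> {1..n}"
  have BG: "B \<subseteq> ?G" using B by (simp add: diagram_def)
  have "cell_root x \<noteq> - cell_root y" if "x \<in> ?G" "y \<in> ?G" for x y
  proof
    assume "cell_root x = - cell_root y"
    moreover obtain i j where x: "x = (i, j)" by (cases x)
    moreover obtain k l where y: "y = (k, l)" by (cases y)
    ultimately have "row_weight m (i - 1) - row_weight m (m + j - 1) =
        row_weight m (m + l - 1) - row_weight m (k - 1)"
      using that by (simp add: cell_root_rows[of _ m])
    then show False using that x y by (subst (asm) row_weight_diff_eq_iff) auto
  qed
  then have disj: "cell_root ` (?G - B) \<inter> uminus ` cell_root ` B = {}" using BG by blast
  have "(\<Sum>\<alpha>\<in>ordered_roots m n (shuffle_pos m B) \<inter> odd_roots m n. \<alpha>) =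
      (\<Sum>\<alpha>\<in>cell_root ` (?G - B). \<alpha>) + (\<Sum>\<alpha>\<in>uminus ` cell_root ` B. \<alpha>)"
    unfolding ordered_odd_roots[OF B] using disj finite_diagram[OF B]
    by (intro sum.union_disjoint) auto
  also have "(\<Sum>\<alpha>\<in>cell_root ` (?G - B). \<alpha>) = (\<Sum>x\<in>?G. cell_root x) - (\<Sum>x\<in>B. cell_root x)"
    using BG sum_cell_root[of "?G - B" m n "\<lambda>\<alpha>. \<alpha>"] by (simp add: sum_diff)
  also have "(\<Sum>\<alpha>\<in>uminus ` cell_root ` B. \<alpha>) = - (\<Sum>x\<in>B. cell_root x)"
    using sum_cell_root[OF BG, of uminus] by (simp add: sum.reindex sum_negf)
  finally show ?thesis by (simp add: wscale_def fun_eq_iff algebra_simps)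
qed

text \<open>The even positive roots are the same for all diagrams. Each cell of B reverses one odd
  root, which changes the odd sum by -2 times that root; with the factor -1/2, rho gains exactly one
  copy of it.\<close>

lemma rho_diagram:
  assumes B: "diagram m n B" and S: "positive_roots m n S = ordered_roots m n (shuffle_pos m B)"
  shows "rho m n S = rho m n (dist_base m n) + (\<Sum>x\<in>B. cell_root x)"
proof -
  have "positive_roots m n (dist_base m n) = ordered_roots m n (shuffle_pos m {})"
    by (simp add: positive_roots_dist_base shuffle_pos_empty)
  then show ?thesis
    unfolding rho_def S ordered_even_roots[OF B] sum_ordered_odd_roots[OF B]
    by (simp add: ordered_even_roots[OF diagram_empty] sum_ordered_odd_roots[OF diagram_empty])
      (simp add: wscale_def fun_eq_iff algebra_simps)
qed

section \<open>Coordinates of the distinguished Weyl vector\<close>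

lemma sum_even_row_pairs:
  "(\<Sum>\<alpha>\<in>(\<lambda>(p, q). row_weight m p - row_weight m q) ` even_row_pairs m n. \<alpha>) (index_of m r) =
    of_nat (card {q. (r, q) \<in> even_row_pairs m n}) - of_nat (card {p. (p, r) \<in> even_row_pairs m n})"
proof -
  let ?X = "even_row_pairs m n"
  have inj: "inj_on (\<lambda>(p, q). row_weight m p - row_weight m q) ?X"
    by (rule inj_onI) (auto simp: even_row_pairs_def row_weight_diff_eq_iff)
  have eq: "?X \<inter> {x. fst x = r} = Pair r ` {q. (r, q) \<in> ?X}"
      "?X \<inter> {x. snd x = r} = (\<lambda>p. (p, r)) ` {p. (p, r) \<in> ?X}" by auto
  have "card (?X \<inter> {x. fst x = r}) = card {q. (r, q) \<in> ?X}"
      "card (?X \<inter> {x. snd x = r}) = card {p. (p, r) \<in> ?X}"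
    unfolding eq by (auto intro!: card_image inj_onI)
  moreover have "(\<Sum>\<alpha>\<in>(\<lambda>(p, q). row_weight m p - row_weight m q) ` ?X. \<alpha>) (index_of m r) =
      (\<Sum>x\<in>?X. of_bool (fst x = r) - of_bool (snd x = r))"
    unfolding sum.reindex[OF inj] weight_sum_apply
    by (intro sum.cong) (auto simp: row_weight_apply)
  ultimately show ?thesis
    using finite_even_row_pairs by (simp add: sum_subtractf sum_of_bool_eq)
qed

lemma index_of_eps: "i \<in> {1..m} \<Longrightarrow> index_of m (i - 1) = int i"
  by (auto simp: index_of_def)

lemma index_of_del: "1 \<le> j \<Longrightarrow> index_of m (m + j - 1) = - int j"
  by (auto simp: index_of_def)

lemma cell_root_eps: "1 \<le> k \<Longrightarrow> cell_root x (int k) = of_bool (fst x = k)"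
  by (cases x) (auto simp: cell_root_def eps_def del_def)

lemma cell_root_del: "1 \<le> k \<Longrightarrow> cell_root x (- int k) = - of_bool (snd x = k)"
  by (cases x) (auto simp: cell_root_def eps_def del_def)

definition rho_shift :: "nat \<Rightarrow> nat \<Rightarrow> complex" where
  "rho_shift m n = (if even (m + n) then 1/2 else 0)"

text \<open>The even part gives the usual (m + 1 - 2 i) / 2 and (n + 1 - 2 j) / 2, as half the
  number of positive roots beginning at a row minus those ending there. The odd part gives - n / 2
  and m / 2, since the rows of the rectangle have n cells and its columns m.\<close>

lemma rho_dist_base:
  shows "i \<in> {1..m} \<Longrightarrow> rho m n (dist_base m n) (int i) =
      (of_nat m + 1 - 2 * of_nat i - of_nat n) / 2 + rho_shift m n"
    and "j \<in> {1..n} \<Longrightarrow> rho m n (dist_base m n) (- int j) =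
      (of_nat n + 1 - 2 * of_nat j + of_nat m) / 2 - rho_shift m n"
proof -
  let ?G = "{1..m} \<times> {1..n}"
  have pos: "positive_roots m n (dist_base m n) = ordered_roots m n (shuffle_pos m {})"
    by (simp add: positive_roots_dist_base shuffle_pos_empty)
  define e where "e = (\<Sum>\<alpha>\<in>(\<lambda>(p, q). row_weight m p - row_weight m q) ` even_row_pairs m n. \<alpha>)"
  have rho: "rho m n (dist_base m n) k = e k / 2 - (\<Sum>x\<in>?G. cell_root x k) / 2 +
      rho_shift m n * ((\<Sum>i\<in>{1..m}. eps i k) - (\<Sum>j\<in>{1..n}. del j k))" for k
    unfolding rho_def pos ordered_even_roots[OF diagram_empty] e_def[symmetric]
    by (simp add: sum_ordered_odd_roots[OF diagram_empty, simplified] wscale_def weight_sum_apply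
        rho_shift_def)
  show "rho m n (dist_base m n) (int i) =
      (of_nat m + 1 - 2 * of_nat i - of_nat n) / 2 + rho_shift m n" if i: "i \<in> {1..m}"
  proof -
    have "{q. (i - 1, q) \<in> even_row_pairs m n} = {i..<m}" "{p. (p, i - 1) \<in> even_row_pairs m n} = {..<i - 1}"
      using i by (auto simp: even_row_pairs_def)
    then have "e (int i) = of_nat (m - i) - of_nat (i - 1)"
      using sum_even_row_pairs[of m n "i - 1"] unfolding e_def index_of_eps[OF i] by simp
    then have e: "e (int i) = of_nat m + 1 - 2 * of_nat i" using i by (simp add: of_nat_diff)
    have eq: "?G \<inter> {x. fst x = i} = {i} \<times> {1..n}" using i by auto
    have c: "(\<Sum>x\<in>?G. cell_root x (int i)) = of_nat n"
    proof -
      have "(\<Sum>x\<in>?G. cell_root x (int i)) = of_nat (card (?G \<inter> {x. fst x = i}))"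
        using i by (simp add: cell_root_eps sum_of_bool_eq)
      then show ?thesis unfolding eq by simp
    qed
    have "(\<Sum>k\<in>{1..m}. eps k (int i)) = 1" "(\<Sum>j\<in>{1..n}. del j (int i)) = 0"
      using i by (auto simp: eps_def del_def)
    then show ?thesis unfolding rho e c by (simp add: diff_divide_distrib)
  qed
  show "rho m n (dist_base m n) (- int j) =
      (of_nat n + 1 - 2 * of_nat j + of_nat m) / 2 - rho_shift m n" if j: "j \<in> {1..n}"
  proof -
    have "{q. (m + j - 1, q) \<in> even_row_pairs m n} = {m + j..<m + n}"
      "{p. (p, m + j - 1) \<in> even_row_pairs m n} = {m..<m + j - 1}"
      using j by (auto simp: even_row_pairs_def)
    then have "e (- int j) = of_nat (n - j) - of_nat (j - 1)"
      using sum_even_row_pairs[of m n "m + j - 1"] j index_of_del[of j m] unfolding e_def by simp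
    then have e: "e (- int j) = of_nat n + 1 - 2 * of_nat j" using j by (simp add: of_nat_diff)
    have eq: "?G \<inter> {x. snd x = j} = {1..m} \<times> {j}" using j by auto
    have c: "(\<Sum>x\<in>?G. cell_root x (- int j)) = - of_nat m"
    proof -
      have "(\<Sum>x\<in>?G. cell_root x (- int j)) = - of_nat (card (?G \<inter> {x. snd x = j}))"
        using j by (simp add: cell_root_del sum_negf sum_of_bool_eq)
      then show ?thesis unfolding eq by simp
    qed
    have "(\<Sum>k\<in>{1..m}. eps k (- int j)) = 0" "(\<Sum>k\<in>{1..n}. del k (- int j)) = 1"
      using j by (auto simp: eps_def del_def)
    then show ?thesis unfolding rho e c by (simp add: diff_divide_distrib add_divide_distrib)
  qed
qed

text \<open>Both numerators have the parity of m + n + 1, so halves occur exactly for even m + n,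
  which is when the shift is 1/2.\<close>

lemma rho_shift_Ints:
  "(of_nat m + 1 - of_nat n) / 2 + rho_shift m n \<in> \<int>"
  "(of_nat n + 1 + of_nat m) / 2 - rho_shift m n \<in> \<int>"
proof -
  have "((of_nat m + 1 - of_nat n) / 2 + rho_shift m n \<in> \<int>) \<and>
    ((of_nat n + 1 + of_nat m) / 2 - rho_shift m n \<in> \<int>)"
  proof (cases "even (m + n)")
    case True
    then obtain k where k: "m + n = 2 * k" by blast
    then have "m = 2 * k - n" "n \<le> 2 * k" by auto
    then have "(of_nat m :: complex) = 2 * of_nat k - of_nat n" by (simp add: of_nat_diff)
    then have "(of_nat m + 1 - of_nat n) / 2 + rho_shift m n = of_int (int k - int n + 1)"
      "(of_nat n + 1 + of_nat m) / 2 - rho_shift m n = of_int (int k)"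
      using True by (simp_all add: rho_shift_def field_simps)
    then show ?thesis by (metis Ints_of_int)
  next
    case False
    then obtain k where k: "m + n = 2 * k + 1" by (rule oddE)
    then have "m = 2 * k + 1 - n" "n \<le> 2 * k + 1" by auto
    then have "(of_nat m :: complex) = 2 * of_nat k + 1 - of_nat n" by (simp add: of_nat_diff)
    then have "(of_nat m + 1 - of_nat n) / 2 + rho_shift m n = of_int (int k - int n + 1)"
      "(of_nat n + 1 + of_nat m) / 2 - rho_shift m n = of_int (int k + 1)"
      using False by (simp_all add: rho_shift_def field_simps)
    then show ?thesis by (metis Ints_of_int)
  qed
  then show "(of_nat m + 1 - of_nat n) / 2 + rho_shift m n \<in> \<int>"
    "(of_nat n + 1 + of_nat m) / 2 - rho_shift m n \<in> \<int>" by auto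
qed

lemma rho_dist_base_Ints:
  shows "i \<in> {1..m} \<Longrightarrow> rho m n (dist_base m n) (int i) \<in> \<int>"
    and "j \<in> {1..n} \<Longrightarrow> rho m n (dist_base m n) (- int j) \<in> \<int>"
proof -
  assume i: "i \<in> {1..m}"
  have "rho m n (dist_base m n) (int i) =
      ((of_nat m + 1 - of_nat n) / 2 + rho_shift m n) - of_nat i"
    unfolding rho_dist_base(1)[OF i] by (simp add: field_simps)
  then show "rho m n (dist_base m n) (int i) \<in> \<int>" using rho_shift_Ints by simp
next
  assume j: "j \<in> {1..n}"
  have "rho m n (dist_base m n) (- int j) =
      ((of_nat n + 1 + of_nat m) / 2 - rho_shift m n) - of_nat j"
    unfolding rho_dist_base(2)[OF j] by (simp add: field_simps)
  then show "rho m n (dist_base m n) (- int j) \<in> \<int>" using rho_shift_Ints by simp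
qed

lemma of_int_int_coord: "\<nu> k \<in> \<int> \<Longrightarrow> of_int (int_coord \<nu> k) = \<nu> k"
  by (elim Ints_cases) (simp add: int_coord_def)

text \<open>Within each block the Weyl vector drops by 1 from one coordinate to the next, which
  turns weak dominance into the strict inequalities on which the row insertion rests.\<close>

lemma dominant_shifted_coords:
  assumes lam: "lam \<in> dominant_weights m n"
  defines "a \<equiv> int_coord (lam + rho m n (dist_base m n))"
  shows "i \<in> {1..m} \<Longrightarrow> of_int (a (int i)) = lam (int i) + rho m n (dist_base m n) (int i)"
    and "j \<in> {1..n} \<Longrightarrow> of_int (a (- int j)) = lam (- int j) + rho m n (dist_base m n) (- int j)"
    and "1 \<le> i \<Longrightarrow> i < k \<Longrightarrow> k \<le> m \<Longrightarrow> a (int k) < a (int i)"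
    and "1 \<le> j \<Longrightarrow> j < l \<Longrightarrow> l \<le> n \<Longrightarrow> a (- int l) < a (- int j)"
proof -
  have Ints: "lam k \<in> \<int>" for k using lam by (simp add: dominant_weights_def)
  have eps: "of_int (a (int i)) = lam (int i) + rho m n (dist_base m n) (int i)" if "i \<in> {1..m}" for i
    unfolding a_def using Ints rho_dist_base_Ints(1)[OF that] by (subst of_int_int_coord) auto
  have del: "of_int (a (- int j)) = lam (- int j) + rho m n (dist_base m n) (- int j)" if "j \<in> {1..n}" for j
    unfolding a_def using Ints rho_dist_base_Ints(2)[OF that] by (subst of_int_int_coord) auto
  show "i \<in> {1..m} \<Longrightarrow> of_int (a (int i)) = lam (int i) + rho m n (dist_base m n) (int i)"
    "j \<in> {1..n} \<Longrightarrow> of_int (a (- int j)) = lam (- int j) + rho m n (dist_base m n) (- int j)"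
    by (fact eps, fact del)
  show "a (int k) < a (int i)" if "1 \<le> i" "i < k" "k \<le> m"
  proof -
    have ik: "i \<in> {1..m}" "k \<in> {1..m}" using that by auto
    have "(of_int (a (int i) - a (int k)) :: complex) =
        of_int (int_coord lam (int i) - int_coord lam (int k) + (int k - int i))"
      using rho_dist_base(1)[OF ik(1), of n] rho_dist_base(1)[OF ik(2), of n]
      by (simp add: eps[OF ik(1)] eps[OF ik(2)] of_int_int_coord Ints diff_divide_distrib)
    then have "a (int i) - a (int k) = int_coord lam (int i) - int_coord lam (int k) + (int k - int i)"
      by (simp only: of_int_eq_iff)
    moreover have "int_coord lam (int i) \<ge> int_coord lam (int k)"
      using lam that by (auto simp: dominant_weights_def)
    ultimately show ?thesis using that by linarith
  qed
  show "a (- int l) < a (- int j)" if "1 \<le> j" "j < l" "l \<le> n"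
  proof -
    have jl: "j \<in> {1..n}" "l \<in> {1..n}" using that by auto
    have "(of_int (a (- int j) - a (- int l)) :: complex) =
        of_int (int_coord lam (- int j) - int_coord lam (- int l) + (int l - int j))"
      using rho_dist_base(2)[OF jl(1), of m] rho_dist_base(2)[OF jl(2), of m]
      by (simp add: del[OF jl(1)] del[OF jl(2)] of_int_int_coord Ints diff_divide_distrib add_divide_distrib)
    then have "a (- int j) - a (- int l) =
        int_coord lam (- int j) - int_coord lam (- int l) + (int l - int j)"
      by (simp only: of_int_eq_iff)
    moreover have "int_coord lam (- int j) \<ge> int_coord lam (- int l)"
      using lam that by (auto simp: dominant_weights_def)
    ultimately show ?thesis using that by linarith
  qed
qed

lemma change_tracking_cell:
  assumes "i \<in> {1..m}" "j \<in> {1..n}"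
  shows "change_tracking m n lam (cell_root (i, j)) =
    of_bool (arrow_cell m n (int_coord (lam + rho m n (dist_base m n))) i j)"
proof -
  have "i' = i \<and> j' = j" if "cell_root (i, j) = eps i' - del j'" "i' \<in> {1..m}" "j' \<in> {1..n}" for i' j'
    using inj_onD[OF inj_on_cell_root, of "(i, j)" "(i', j')" m n] that assms by (auto simp: cell_root_def)
  moreover have "cell_root (i, j) = eps i - del j" by (simp add: cell_root_def)
  ultimately show ?thesis using assms
    unfolding change_tracking_def Let_def arrow_cell_def by (auto simp: of_bool_def)
qed

subsection \<open>Highest weights along a chain of odd reflections\<close>

text \<open>An odd reflection at a cell that is not marked by the arrow diagram changes the highest weight
  by the root of that cell.\<close>

definition diagram_weight ::
    "nat \<Rightarrow> nat \<Rightarrow> (int \<Rightarrow> int) \<Rightarrow> weight \<Rightarrow> (nat \<times> nat) set \<Rightarrow> weight" where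
  "diagram_weight m n a lam B =
     lam - (\<Sum>x\<in>B. wscale (of_bool (\<not> arrow_cell m n a (fst x) (snd x))) (cell_root x))"

lemma diagram_weight_insert:
  assumes "finite B" "x \<notin> B"
  shows "diagram_weight m n a lam (insert x B) =
    diagram_weight m n a lam B - wscale (of_bool (\<not> arrow_cell m n a (fst x) (snd x))) (cell_root x)"
  using assms by (simp add: diagram_weight_def algebra_simps)

lemma of_nat_card_Collect_not:
  assumes "finite A"
  shows "(of_nat (card {x \<in> A. \<not> P x}) :: 'a::ring_1) = of_nat (card A) - of_nat (card {x \<in> A. P x})"
proof -
  have "card A = card {x \<in> A. P x} + card {x \<in> A. \<not> P x}"
    using assms by (subst card_Un_disjoint[symmetric]) (auto intro: arg_cong[where f = card])
  then show ?thesis by simp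
qed

text \<open>The two coordinates involved in the reflection see only the cells of row i and of column
  j. At an addable corner these are the first j - 1 cells of the row and the rows i + 1, ..., m of
  the column, whatever the rest of B is.\<close>

lemma diagram_weight_corner:
  assumes B: "diagram m n B" and corner: "(i, j) \<notin> B" "diagram m n (insert (i, j) B)"
  shows "diagram_weight m n a lam B (int i) =
      lam (int i) - (of_nat j - 1 - of_nat (card {l \<in> {1..<j}. arrow_cell m n a i l}))"
    and "diagram_weight m n a lam B (- int j) =
      lam (- int j) + (of_nat m - of_nat i - of_nat (card {k \<in> {i<..m}. arrow_cell m n a k j}))"
proof -
  note ij = corner_bounds[OF B corner]
  note fin = finite_diagram[OF B]
  let ?c = "\<lambda>x. arrow_cell m n a (fst x) (snd x)"
  have "diagram_weight m n a lam B (int i) =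
      lam (int i) - (\<Sum>x\<in>B. of_bool (\<not> ?c x \<and> fst x = i))"
    using ij by (simp add: diagram_weight_def weight_sum_apply wscale_def cell_root_eps of_bool_conj)
  also have "(\<Sum>x\<in>B. of_bool (\<not> ?c x \<and> fst x = i)) = (of_nat (card (B \<inter> {x. \<not> ?c x \<and> fst x = i})) :: complex)"
    using fin by (simp add: sum_of_bool_eq)
  also have "B \<inter> {x. \<not> ?c x \<and> fst x = i} = Pair i ` {l \<in> {1..<j}. \<not> arrow_cell m n a i l}"
    using corner_row[OF B corner] by (auto simp: set_eq_iff)
  also have "card \<dots> = card {l \<in> {1..<j}. \<not> arrow_cell m n a i l}"
    by (intro card_image inj_onI) auto
  finally show "diagram_weight m n a lam B (int i) =
      lam (int i) - (of_nat j - 1 - of_nat (card {l \<in> {1..<j}. arrow_cell m n a i l}))"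
    using ij by (subst (asm) of_nat_card_Collect_not) (auto simp: of_nat_diff)
  have "diagram_weight m n a lam B (- int j) =
      lam (- int j) + (\<Sum>x\<in>B. of_bool (\<not> ?c x \<and> snd x = j))"
    using ij by (simp add: diagram_weight_def weight_sum_apply wscale_def cell_root_del of_bool_conj sum_negf)
  also have "(\<Sum>x\<in>B. of_bool (\<not> ?c x \<and> snd x = j)) = (of_nat (card (B \<inter> {x. \<not> ?c x \<and> snd x = j})) :: complex)"
    using fin by (simp add: sum_of_bool_eq)
  also have "B \<inter> {x. \<not> ?c x \<and> snd x = j} = (\<lambda>k. (k, j)) ` {k \<in> {i<..m}. \<not> arrow_cell m n a k j}"
  proof (intro Set.set_eqI iffI)
    fix x assume "x \<in> B \<inter> {x. \<not> ?c x \<and> snd x = j}"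
    then obtain k where k: "x = (k, j)" "(k, j) \<in> B" "\<not> arrow_cell m n a k j" by (cases x) auto
    then show "x \<in> (\<lambda>k. (k, j)) ` {k \<in> {i<..m}. \<not> arrow_cell m n a k j}"
      using corner_column[OF B corner, of k] diagram_bounds[OF B k(2)] by auto
  next
    fix x assume "x \<in> (\<lambda>k. (k, j)) ` {k \<in> {i<..m}. \<not> arrow_cell m n a k j}"
    then obtain k where "x = (k, j)" "i < k" "k \<le> m" "\<not> arrow_cell m n a k j" by auto
    then show "x \<in> B \<inter> {x. \<not> ?c x \<and> snd x = j}"
      using corner_column[OF B corner, of k] ij by auto
  qed
  also have "card \<dots> = card {k \<in> {i<..m}. \<not> arrow_cell m n a k j}"
    by (intro card_image inj_onI) auto
  finally show "diagram_weight m n a lam B (- int j) =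
      lam (- int j) + (of_nat m - of_nat i - of_nat (card {k \<in> {i<..m}. arrow_cell m n a k j}))"
    using ij by (subst (asm) of_nat_card_Collect_not) (auto simp: of_nat_diff)
qed

context gl_supermodule
begin

text \<open>Cells are added in the order of (m - i) + j, so that each new cell is an addable corner
  of a smaller diagram.\<close>

lemma singular_diagram:
  assumes "simple" and lam: "lam \<in> dominant_weights m n"
    and sing: "singular Suc (\<lambda>r. lam (index_of m r)) v"
    and B: "diagram m n B"
  defines "a \<equiv> int_coord (lam + rho m n (dist_base m n))"
  shows "\<exists>w. singular (shuffle_pos m B) (\<lambda>r. diagram_weight m n a lam B (index_of m r)) w"
  using finite_diagram[OF B] B
proof (induction B rule: finite_ranking_induct[where f = "\<lambda>x. (m - fst x) + snd x"])
  case empty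
  show ?case using sing by (auto simp: shuffle_pos_empty diagram_weight_def)
next
  case (insert x B)
  show ?case
  proof (cases "x \<in> B")
    case True
    then show ?thesis using insert by (simp add: insert_absorb)
  next
    case False
    obtain i j where x: "x = (i, j)" by (cases x)
    have D: "diagram m n (insert (i, j) B)" using insert.prems x by simp
    have nB: "(i, j) \<notin> B" using False x by simp
    have B: "diagram m n B" unfolding diagram_def
    proof (intro conjI allI impI)
      show "B \<subseteq> {1..m} \<times> {1..n}" using D by (auto simp: diagram_def)
      fix k l k' l' assume *: "(k, l) \<in> B" "k \<le> k'" "k' \<le> m" "1 \<le> l'" "l' \<le> l"
      then have "(k', l') \<in> insert (i, j) B" using diagram_down[OF D, of k l k' l'] by simp
      \<comment> \<open>Only a cell of at least the same rank could require (i, j), and since (i, j)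
        has the greatest rank, that cell would be (i, j) itself.\<close>
      moreover have "(k', l') \<noteq> (i, j)"
      proof
        assume "(k', l') = (i, j)"
        moreover have "(m - k) + l \<le> (m - i) + j" using insert.hyps(2)[OF *(1)] x by simp
        ultimately have "k = i \<and> l = j" using * by auto
        with * nB show False by simp
      qed
      ultimately show "(k', l') \<in> B" by blast
    qed
    note ij = corner_bounds[OF B nB D]
    define \<nu> where "\<nu> = diagram_weight m n a lam B"
    from insert.IH[OF B] obtain w where
      w: "singular (shuffle_pos m B) (\<lambda>r. \<nu> (index_of m r)) w" unfolding \<nu>_def by blast
    note coords = dominant_shifted_coords[OF lam, folded a_def]
    \<comment> \<open>The two rho-coordinates add up to m + 1 - i - j. This equals the contribution
      m - i of the column minus j - 1 of the row, so only the shifted coordinates and the numbers of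
      marked cells remain.\<close>
    have "\<nu> (int i) + \<nu> (- int j) =
        of_int (a (int i) + int (card {l \<in> {1..<j}. arrow_cell m n a i l}) + a (- int j)
          - int (card {k \<in> {i<..m}. arrow_cell m n a k j}))"
      unfolding \<nu>_def diagram_weight_corner[OF B nB D]
      by (simp add: coords(1)[OF ij(1)] coords(2)[OF ij(2)] rho_dist_base(1)[OF ij(1)]
          rho_dist_base(2)[OF ij(2)] field_simps)
    then have zero: "\<nu> (int i) + \<nu> (- int j) = 0 \<longleftrightarrow> arrow_cell m n a i j"
      using arrow_cell_iff[of m a n i j] coords(3,4) ij
      by (simp only: of_int_eq_0_iff) auto
    have rs: "i - 1 < m" "m \<le> m + j - 1" "m + j - 1 < m + n" using ij by auto
    have index: "index_of m (i - 1) = int i" "index_of m (m + j - 1) = - int j"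
      using ij by (auto simp only: index_of_eps index_of_del atLeastAtMost_iff)
    obtain u where u: "singular (shuffle_pos m (insert (i, j) B))
        (if \<nu> (int i) + \<nu> (- int j) = 0 then \<lambda>r. \<nu> (index_of m r)
         else (\<lambda>r. \<nu> (index_of m r))(i - 1 := \<nu> (int i) - 1, m + j - 1 := \<nu> (- int j) + 1)) u"
      using odd_reflection[OF \<open>simple\<close> shuffle_pos_inj[OF B] w rs shuffle_pos_corner(1)[OF B nB D]]
      unfolding shuffle_pos_corner(2)[OF B nB D] index by blast
    have "(if \<nu> (int i) + \<nu> (- int j) = 0 then \<lambda>r. \<nu> (index_of m r)
         else (\<lambda>r. \<nu> (index_of m r))(i - 1 := \<nu> (int i) - 1, m + j - 1 := \<nu> (- int j) + 1)) =
        (\<lambda>r. diagram_weight m n a lam (insert (i, j) B) (index_of m r))"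
    proof
      fix r
      have "cell_root (i, j) (index_of m r) = of_bool (r = i - 1) - of_bool (r = m + j - 1)"
        using ij by (auto simp: cell_root_rows[OF ij(1)] row_weight_apply)
      then show "(if \<nu> (int i) + \<nu> (- int j) = 0 then \<lambda>r. \<nu> (index_of m r)
         else (\<lambda>r. \<nu> (index_of m r))(i - 1 := \<nu> (int i) - 1, m + j - 1 := \<nu> (- int j) + 1)) r =
        diagram_weight m n a lam (insert (i, j) B) (index_of m r)"
        using rs index
        unfolding zero diagram_weight_insert[OF finite_diagram[OF B] nB] \<nu>_def[symmetric]
        by (auto simp: wscale_def)
    qed
    with u show ?thesis unfolding x by auto
  qed
qed

text \<open>Singular vectors determine the coordinates in \<open>indices m n\<close>, and all others
  vanish in \<open>weight_space_dual\<close>. So the weight reached by reflections is the unique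
  one, as the definite description in \<open>highest_weight\<close> demands.\<close>

lemma highest_weight_diagram:
  assumes "simple" and lam: "lam \<in> dominant_weights m n"
    and hw: "has_highest_weight (dist_base m n) lam"
    and S: "S \<in> standard_bases m n"
  defines "a \<equiv> int_coord (lam + rho m n (dist_base m n))"
  shows "highest_weight S = diagram_weight m n a lam (base_diagram m n S)"
proof -
  let ?B = "base_diagram m n S"
  let ?\<nu> = "diagram_weight m n a lam ?B"
  note B = diagram_base_diagram[OF S]
  note iff = has_highest_weight_iff_singular[OF positive_roots_base_diagram[OF S]]
  obtain v where "singular Suc (\<lambda>r. lam (index_of m r)) v"
    using hw has_highest_weight_iff_singular[OF positive_roots_dist_base] by blast
  then obtain w where w: "singular (shuffle_pos m ?B) (\<lambda>r. ?\<nu> (index_of m r)) w"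
    using singular_diagram[OF \<open>simple\<close> lam _ B] unfolding a_def by blast
  have "cell_root x k = 0" if "x \<in> ?B" "k \<notin> indices m n" for x k
    using that diagram_bounds[OF B, of "fst x" "snd x"]
    by (cases x) (auto simp: cell_root_def eps_def del_def indices_def)
  then have dual: "?\<nu> \<in> weight_space_dual m n"
    using lam by (auto simp: weight_space_dual_def diagram_weight_def weight_sum_apply
        wscale_def dominant_weights_def)
  have "has_highest_weight S ?\<nu>" using w dual iff by blast
  moreover have "\<mu> = ?\<nu>" if \<mu>: "has_highest_weight S \<mu>" for \<mu>
  proof
    fix k
    show "\<mu> k = ?\<nu> k"
    proof (cases "k \<in> indices m n")
      case True
      then obtain r where r: "r < m + n" "k = index_of m r"
        using bij_betw_index_of[of m n] unfolding bij_betw_def by blast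
      obtain u where "singular (shuffle_pos m ?B) (\<lambda>r. \<mu> (index_of m r)) u"
        using \<mu> iff by blast
      from singular_weight_unique[OF \<open>simple\<close> shuffle_pos_inj[OF B] this w r(1)] r(2)
      show ?thesis by simp
    next
      case False
      then show ?thesis using dual \<mu> iff by (auto simp: weight_space_dual_def)
    qed
  qed
  ultimately show ?thesis unfolding highest_weight_def by (rule the_equality)
qed

end

theorem corollary3:
  fixes scale :: "complex \<Rightarrow> 'v::ab_group_add \<Rightarrow> 'v"
    and m n :: nat
    and V :: "bit \<Rightarrow> 'v set"
    and act :: "complex mat \<Rightarrow> 'v \<Rightarrow> 'v"
    and lam :: weight
    and S :: "weight set"
  assumes "lam \<in> dominant_weights m n"
    and "S \<in> standard_bases m n"
    and "gl_supermodule scale m n V act"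
    and "gl_supermodule.finite_dimensional scale"
    and "gl_supermodule.simple scale m n V act"
    and "gl_supermodule.has_highest_weight scale m n act (dist_base m n) lam"
  shows "gl_supermodule.highest_weight scale m n act S + rho m n S =
           (lam + rho m n (dist_base m n)) +
           (\<Sum>\<alpha>\<in>B_set m n S. wscale (of_nat (change_tracking m n lam \<alpha>)) \<alpha>)"
proof -
  define a where "a = int_coord (lam + rho m n (dist_base m n))"
  let ?B = "base_diagram m n S"
  let ?c = "\<lambda>x. arrow_cell m n a (fst x) (snd x)"
  note B = diagram_base_diagram[OF assms(2)]
  have BG: "?B \<subseteq> {1..m} \<times> {1..n}" using B by (simp add: diagram_def)
  have hw: "gl_supermodule.highest_weight scale m n act S = diagram_weight m n a lam ?B"
    unfolding a_def
    using gl_supermodule.highest_weight_diagram[OF assms(3,5,1,6,2)] .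
  have rho: "rho m n S = rho m n (dist_base m n) + (\<Sum>x\<in>?B. cell_root x)"
    by (rule rho_diagram[OF B positive_roots_base_diagram[OF assms(2)]])
  \<comment> \<open>For each cell, rho contributes the root \<alpha> and the highest weight takes
    back (1 - c) \<alpha>, so that c \<alpha> remains.\<close>
  have "wscale (of_nat (change_tracking m n lam (cell_root x))) (cell_root x) =
      cell_root x - wscale (of_bool (\<not> ?c x)) (cell_root x)" if "x \<in> ?B" for x
    using that BG change_tracking_cell[of "fst x" m "snd x" n lam]
    by (cases x) (auto simp: a_def wscale_def fun_eq_iff)
  then have "(\<Sum>\<alpha>\<in>B_set m n S. wscale (of_nat (change_tracking m n lam \<alpha>)) \<alpha>) =
      (\<Sum>x\<in>?B. cell_root x) - (\<Sum>x\<in>?B. wscale (of_bool (\<not> ?c x)) (cell_root x))"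
    unfolding B_set_base_diagram[OF assms(2)] sum_cell_root[OF BG] sum_subtractf[symmetric]
    by (intro sum.cong) auto
  then show ?thesis unfolding hw rho diagram_weight_def by (simp add: algebra_simps)
qed

end
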